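(* For every non-decreasing function $\delta\colon(0,1)\to(0,1)$ there exist an analytic map $\phi\colon\mathbb{D}\to\mathbb{D}$ which is two-valent and satisfies $\phi(\mathbb{D})=\mathbb{D}\setminus\{0\}$, and a number $0<h_0<1$, such that $$m\big(\{z\in\mathbb{T}\,;\ |\phi^*(z)|\ge 1-h\}\big)\le \delta(h)\qquad\text{for all }0<h\le h_0 .$$ As a consequence, there exists a surjective and four-valent analytic map $\psi\colon\mathbb{D}\to\mathbb{D}$ such that the composition operator $C_\psi\colon H^2\to H^2$ belongs to every Schatten class $S_p(H^2)$, $p>0$.
   Context: $\mathbb{D}$ is the open unit disk, $\mathbb{T}=\partial\mathbb{D}$, $m$ the normalized Lebesgue (Haar) measure on $\mathbb{T}$, $H^2$ the Hardy space of $\mathbb{D}$. For an analytic self-map $\varphi$ of $\mathbb{D}$ (a "symbol"), $\varphi^*(\xi)=\lim_{r\to1^-}\varphi(r\xi)$ is its radial limit function (defined $m$-a.e.), and $C_\varphi f=f\circ\varphi$ is the composition operator. A map is $p$-valent if every $w$ has at most $p$ preimages. The $n$-th approximation number of an operator $T$ between Hilbert spaces is $a_n(T)=\inf\{\|T-R\|:\operatorname{rank}R<n\}$, and $T\in S_p$ means $(a_n(T))_n\in\ell^p$. *)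

theory Defs
  imports "HOL-Analysis.Analysis"
begin

abbreviation unit_disk :: "complex set" where
  "unit_disk \<equiv> ball 0 1"

definition radial_limit :: "(complex \<Rightarrow> complex) \<Rightarrow> complex \<Rightarrow> complex" where
  "radial_limit \<phi> \<xi> = Lim (at_left (1::real)) (\<lambda>r. \<phi> (complex_of_real r * \<xi>))"

definition circle_measure :: "complex set \<Rightarrow> real" where
  "circle_measure A = measure lebesgue {t \<in> {0..<2*pi}. cis t \<in> A} / (2*pi)"

definition circle_measurable :: "complex set \<Rightarrow> bool" where
  "circle_measurable A \<longleftrightarrow> {t \<in> {0..<2*pi}. cis t \<in> A} \<in> sets lebesgue"

definition p_valent :: "nat \<Rightarrow> (complex \<Rightarrow> complex) \<Rightarrow> bool" where
  "p_valent p f \<longleftrightarrow> (\<forall>w. finite {z \<in> unit_disk. f z = w} \<and> card {z \<in> unit_disk. f z = w} \<le> p)"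

definition taylor_coeff :: "(complex \<Rightarrow> complex) \<Rightarrow> nat \<Rightarrow> complex" where
  "taylor_coeff f n = (deriv ^^ n) f 0 / fact n"

definition H2 :: "(complex \<Rightarrow> complex) set" where
  "H2 = {f. f holomorphic_on unit_disk \<and> summable (\<lambda>n. (cmod (taylor_coeff f n))\<^sup>2)}"

definition H2_norm :: "(complex \<Rightarrow> complex) \<Rightarrow> real" where
  "H2_norm f = sqrt (\<Sum>n. (cmod (taylor_coeff f n))\<^sup>2)"

definition H2_opnorm :: "((complex \<Rightarrow> complex) \<Rightarrow> (complex \<Rightarrow> complex)) \<Rightarrow> ereal" where
  "H2_opnorm T = (SUP f \<in> {f \<in> H2. H2_norm f \<le> 1}. ereal (H2_norm (T f)))"

definition H2_linear_op :: "((complex \<Rightarrow> complex) \<Rightarrow> (complex \<Rightarrow> complex)) \<Rightarrow> bool" where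
  "H2_linear_op R \<longleftrightarrow> (\<forall>f\<in>H2. R f \<in> H2) \<and>
     (\<forall>f\<in>H2. \<forall>g\<in>H2. \<forall>a::complex. R (\<lambda>z. a * f z + g z) = (\<lambda>z. a * R f z + R g z))"

definition rank_less :: "((complex \<Rightarrow> complex) \<Rightarrow> (complex \<Rightarrow> complex)) \<Rightarrow> nat \<Rightarrow> bool" where
  "rank_less R n \<longleftrightarrow> (\<exists>gs :: (complex \<Rightarrow> complex) list. length gs < n \<and>
      (\<forall>f\<in>H2. \<exists>c. R f = (\<lambda>z. \<Sum>i<length gs. c i * (gs ! i) z)))"

definition approx_number :: "((complex \<Rightarrow> complex) \<Rightarrow> (complex \<Rightarrow> complex)) \<Rightarrow> nat \<Rightarrow> ereal" where
  "approx_number T n = (INF R \<in> {R. H2_linear_op R \<and> rank_less R n}.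
      H2_opnorm (\<lambda>f. (\<lambda>z. T f z - R f z)))"

definition schatten_class :: "real \<Rightarrow> ((complex \<Rightarrow> complex) \<Rightarrow> (complex \<Rightarrow> complex)) \<Rightarrow> bool" where
  "schatten_class p T \<longleftrightarrow> (\<exists>a :: nat \<Rightarrow> real. (\<forall>n\<ge>1. approx_number T n = ereal (a n)) \<and>
      summable (\<lambda>n. a (Suc n) powr p))"

definition composition_op :: "(complex \<Rightarrow> complex) \<Rightarrow> (complex \<Rightarrow> complex) \<Rightarrow> (complex \<Rightarrow> complex)" where
  "composition_op \<psi> f = f \<circ> \<psi>"

end

theory Submission
  imports Defs "HOL-Complex_Analysis.Complex_Analysis"
begin

text \<open>
  Let \<open>g\<close> be a Riemann map of the disk onto the region \<open>H x < y < H x + 4 * pi\<close>, \<open>x > 0\<close>, where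
  \<open>H\<close> is continuous, vanishes for \<open>x \<ge> 1\<close> and grows fast as \<open>x\<close> tends to 0. Every vertical section
  is an open interval of length \<open>4 * pi\<close>, so \<open>\<phi> = exp (- g)\<close> is two-valent with image the punctured
  disk. Points where \<open>\<bar>\<phi>\<bar>\<close> is close to 1 correspond to points of the region with small \<open>x\<close>, hence
  with large \<open>y\<close>, where the positive harmonic function \<open>Re (K + z + exp (- \<i> z))\<close> exceeds
  \<open>exp (H x) / 2\<close>. Since the circle means of its pullback by \<open>g\<close> equal the value at the origin,
  Markov's inequality bounds the measure of these points by a multiple of \<open>exp (- H x)\<close>.

  Radial limits exist almost everywhere because \<open>1 / (1 + g)\<close> is bounded and univalent: its Dirichlet
  integral is an area, hence finite, so its derivative is integrable along almost every radius.

  For the composition operator, take \<open>H x = max 0 (1 / x - 1)\<close> and compose \<open>\<phi>\<close> with the square of a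
  disk automorphism, which attains its value at 0 also at another point. Truncating the Taylor
  series after \<open>n\<close> terms leaves an error with \<open>\<bar>f (\<psi> z) - R f z\<bar>\<^sup>2 \<le> \<parallel>f\<parallel>\<^sup>2 \<bar>\<psi> z\<bar>\<^sup>2\<^sup>n / (1 - \<bar>\<psi> z\<bar>\<^sup>2)\<close>,
  and the right-hand side is pointwise at most an arbitrary negative power of \<open>n\<close> times the same
  positive harmonic function; so the approximation numbers decay faster than any power.
\<close>

section \<open>Taylor coefficients and approximation numbers\<close>

text \<open>Cauchy's formula for the \<open>k\<close>-th derivative on the circle of radius
  \<open>r\<close>, multiplied by \<open>r ^ k / \<i>\<close> so that it reads as a Fourier
  coefficient of \<open>f\<close> on that circle.\<close>

lemma taylor_coeff_has_integral:
  assumes "f holomorphic_on unit_disk" "0 < r" "r < 1"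
  shows "((\<lambda>t. f (of_real r * cis t) * cis (- (real k * t))) has_integral
           2 * pi * r ^ k * taylor_coeff f k) {0..2*pi}"
proof -
  have sub: "cball 0 r \<subseteq> unit_disk" "ball 0 r \<subseteq> unit_disk"
    using assms by auto
  have "((\<lambda>u. f u / (u-0) ^ (Suc k)) has_contour_integral ((2 * pi * \<i>) / (fact k) * (deriv ^^ k) f 0))
           (circlepath 0 r)"
    by (rule Cauchy_has_contour_integral_higher_derivative_circlepath)
       (use assms sub holomorphic_on_subset holomorphic_on_imp_continuous_on in \<open>auto | blast\<close>)+
  then have "((\<lambda>t. f (of_real r * cis t) / (of_real r * cis t) ^ Suc k * of_real r * \<i> * cis t)
      has_integral ((2 * pi * \<i>) / (fact k) * (deriv ^^ k) f 0)) {0..2*pi}"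
    unfolding circlepath_def by (subst (asm) has_contour_integral_part_circlepath_iff) auto
  then have "((\<lambda>t. f (of_real r * cis t) / (of_real r * cis t) ^ Suc k * of_real r * \<i> * cis t * (of_real r ^ k / \<i>))
      has_integral ((2 * pi * \<i>) / (fact k) * (deriv ^^ k) f 0) * (of_real r ^ k / \<i>)) {0..2*pi}"
    by (rule has_integral_mult_left)
  moreover have "f (of_real r * cis t) / (of_real r * cis t) ^ Suc k * of_real r * \<i> * cis t * (of_real r ^ k / \<i>)
      = f (of_real r * cis t) * cis (- (real k * t))" for t
  proof -
    have "cis (- (real k * t)) = inverse (cis t ^ k)"
      by (metis Complex.DeMoivre cis_inverse)
    then show ?thesis
      using assms by (simp add: field_simps power_mult_distrib)
  qed
  ultimately show ?thesis
    by (simp add: taylor_coeff_def mult_ac)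
qed

lemma holomorphic_mean_value:
  fixes f :: "complex \<Rightarrow> complex"
  assumes "f holomorphic_on unit_disk" "0 < r" "r < 1"
  shows "((\<lambda>t. f (of_real r * cis t)) has_integral 2 * pi * f 0) {0..2*pi}"
  using taylor_coeff_has_integral[OF assms, of 0] by (simp add: taylor_coeff_def)

lemma taylor_coeff_power: "taylor_coeff (\<lambda>z. z ^ j) k = (if j = k then 1 else 0)"
proof -
  have "(deriv ^^ k) (\<lambda>z. z ^ j) (0::complex) = pochhammer (of_nat (Suc j - k)) k * 0 ^ (j - k)"
    using higher_deriv_power[of k 0 j 0] by simp
  moreover have "pochhammer (0::complex) k = 0" if "k > j"
    using that by (simp add: pochhammer_0_left)
  ultimately show ?thesis
    by (cases j k rule: linorder_cases)
       (simp_all add: taylor_coeff_def pochhammer_fact[symmetric])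
qed

lemma taylor_coeff_linear:
  assumes "f holomorphic_on unit_disk" "g holomorphic_on unit_disk"
  shows "taylor_coeff (\<lambda>z. a * f z + g z) k = a * taylor_coeff f k + taylor_coeff g k"
proof -
  have "(deriv ^^ k) (\<lambda>z. a * f z + g z) 0 = (deriv ^^ k) (\<lambda>z. a * f z) 0 + (deriv ^^ k) g 0"
    by (rule higher_deriv_add[where S = unit_disk]) (use assms in \<open>auto intro!: holomorphic_intros\<close>)
  also have "(deriv ^^ k) (\<lambda>z. a * f z) 0 = a * (deriv ^^ k) f 0"
    by (rule higher_deriv_cmult[where A = unit_disk]) (use assms in auto)
  finally show ?thesis
    by (simp add: taylor_coeff_def add_divide_distrib)
qed

lemma taylor_coeff_sums:
  assumes "f holomorphic_on unit_disk" "z \<in> unit_disk"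
  shows "(\<lambda>k. taylor_coeff f k * z ^ k) sums f z"
  using holomorphic_power_series[OF assms] by (simp add: taylor_coeff_def)

section \<open>Harmonic majorants and the Hardy norm\<close>

text \<open>The integral of \<open>\<bar>f - p\<bar>^2\<close> over the circle is nonnegative,
  \<open>p\<close> being the Taylor polynomial of degree below \<open>J\<close>. Orthogonality gives
  \<open>f * cnj p\<close> and \<open>p * cnj p\<close> the same integral \<open>2 * pi * S\<close>,
  and the mean of the majorant \<open>Re U\<close> is its value at 0.\<close>

lemma bessel_circle:
  assumes f: "f holomorphic_on unit_disk" and U: "U holomorphic_on unit_disk"
    and le: "\<And>z. z \<in> unit_disk \<Longrightarrow> (cmod (f z))\<^sup>2 \<le> Re (U z)"
    and r: "0 < r" "r < 1"
  shows "(\<Sum>k<J. (cmod (taylor_coeff f k))\<^sup>2 * r ^ (2*k)) \<le> Re (U 0)"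
proof -
  define c where "c k = taylor_coeff f k * of_real r ^ k" for k
  define p where "p z = (\<Sum>j<J. taylor_coeff f j * z ^ j)" for z
  define S where "S = (\<Sum>k<J. (cmod (taylor_coeff f k))\<^sup>2 * r ^ (2*k))"
  have S: "S = (\<Sum>k<J. (cmod (c k))\<^sup>2)"
    by (simp add: S_def c_def norm_mult norm_power power_mult_distrib power_mult[symmetric] r
        abs_of_pos mult.commute)
  have cnj_p: "cnj (p (of_real r * cis t)) = (\<Sum>k<J. cnj (c k) * cis (- (real k * t)))" for t
  proof -
    have "cnj (cis t ^ k) = cis (- (real k * t))" for k
      by (metis Complex.DeMoivre cis_cnj)
    then show ?thesis
      by (simp add: p_def c_def power_mult_distrib mult_ac del: complex_cnj_power)
  qed
  \<comment> \<open>Only the Fourier coefficients of order below \<open>J\<close> enter, so one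
    computation serves for both \<open>q = f\<close> and \<open>q = p\<close>.\<close>
  have key: "((\<lambda>t. q (of_real r * cis t) * cnj (p (of_real r * cis t))) has_integral of_real (2 * pi * S)) {0..2*pi}"
    if "\<And>k. k < J \<Longrightarrow> ((\<lambda>t. q (of_real r * cis t) * cis (- (real k * t))) has_integral 2 * pi * c k) {0..2*pi}"
    for q
  proof -
    have "((\<lambda>t. \<Sum>k<J. cnj (c k) * (q (of_real r * cis t) * cis (- (real k * t))))
        has_integral (\<Sum>k<J. cnj (c k) * (2 * pi * c k))) {0..2*pi}"
      by (intro has_integral_sum has_integral_mult_right that) auto
    moreover have "(\<Sum>k<J. cnj (c k) * (2 * pi * c k)) = of_real (2 * pi * S)"
    proof -
      have "cnj (c k) * (2 * pi * c k) = of_real (2 * pi * (cmod (c k))\<^sup>2)" for k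
        using complex_norm_square[of "c k"] by (simp add: mult_ac)
      then show ?thesis by (simp only: S sum_distrib_left of_real_sum)
    qed
    moreover have "q (of_real r * cis t) * cnj (p (of_real r * cis t)) =
        (\<Sum>k<J. cnj (c k) * (q (of_real r * cis t) * cis (- (real k * t))))" for t
      unfolding cnj_p sum_distrib_left by (simp add: mult_ac)
    ultimately show ?thesis by simp
  qed
  have i1: "((\<lambda>t. f (of_real r * cis t) * cnj (p (of_real r * cis t))) has_integral of_real (2 * pi * S)) {0..2*pi}"
    by (rule key) (use taylor_coeff_has_integral[OF f r] in \<open>simp add: c_def mult_ac\<close>)
  have i2: "((\<lambda>t. p (of_real r * cis t) * cnj (p (of_real r * cis t))) has_integral of_real (2 * pi * S)) {0..2*pi}"
  proof (rule key)
    fix k assume k: "k < J"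
    have "((\<lambda>t. (of_real r * cis t) ^ j * cis (- (real k * t)))
       has_integral 2 * pi * r ^ k * (if j = k then 1 else 0)) {0..2*pi}" for j
      using taylor_coeff_has_integral[of "\<lambda>z. z ^ j" r k] r
      by (simp add: taylor_coeff_power holomorphic_intros split: if_splits)
    then have "((\<lambda>t. \<Sum>j<J. taylor_coeff f j * ((of_real r * cis t) ^ j * cis (- (real k * t))))
       has_integral (\<Sum>j<J. taylor_coeff f j * (2 * pi * r ^ k * (if j = k then 1 else 0)))) {0..2*pi}"
      by (intro has_integral_sum has_integral_mult_right) auto
    moreover have "(\<Sum>j<J. taylor_coeff f j * (2 * pi * r ^ k * (if j = k then 1 else 0))) = 2 * pi * c k"
    proof -
      have "(\<Sum>j<J. taylor_coeff f j * (2 * pi * r ^ k * (if j = k then 1 else 0)))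
          = (\<Sum>j<J. if j = k then 2 * pi * c k else 0)"
        by (intro sum.cong) (auto simp: c_def)
      then show ?thesis using k by simp
    qed
    ultimately show "((\<lambda>t. p (of_real r * cis t) * cis (- (real k * t))) has_integral 2 * pi * c k) {0..2*pi}"
      by (simp add: p_def sum_distrib_right mult.assoc)
  qed
  have i3: "((\<lambda>t. U (of_real r * cis t)) has_integral 2 * pi * U 0) {0..2*pi}"
    using holomorphic_mean_value[OF U r] .
  have "((\<lambda>t. U (of_real r * cis t) - 2 * (f (of_real r * cis t) * cnj (p (of_real r * cis t)))
       + p (of_real r * cis t) * cnj (p (of_real r * cis t)))
      has_integral 2 * pi * U 0 - 2 * of_real (2 * pi * S) + of_real (2 * pi * S)) {0..2*pi}"
    by (intro has_integral_add has_integral_diff has_integral_mult_right i1 i2 i3)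
  then have "((\<lambda>t. Re (U (of_real r * cis t) - 2 * (f (of_real r * cis t) * cnj (p (of_real r * cis t)))
       + p (of_real r * cis t) * cnj (p (of_real r * cis t))))
      has_integral Re (2 * pi * U 0 - 2 * of_real (2 * pi * S) + of_real (2 * pi * S))) {0..2*pi}"
    by (rule has_integral_Re)
  then have "0 \<le> Re (2 * pi * U 0 - 2 * of_real (2 * pi * S) + of_real (2 * pi * S))"
  proof (rule has_integral_nonneg)
    fix t
    let ?w = "of_real r * cis t"
    have "0 \<le> (cmod (f ?w - p ?w))\<^sup>2" by simp
    also have "\<dots> = (cmod (f ?w))\<^sup>2 + Re (- 2 * (f ?w * cnj (p ?w)) + p ?w * cnj (p ?w))"
      unfolding cmod_power2 by (simp add: power2_eq_square algebra_simps)
    also have "\<dots> \<le> Re (U ?w) + Re (- 2 * (f ?w * cnj (p ?w)) + p ?w * cnj (p ?w))"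
      using le[of ?w] r by (simp add: norm_mult)
    finally show "0 \<le> Re (U ?w - 2 * (f ?w * cnj (p ?w)) + p ?w * cnj (p ?w))"
      by simp
  qed
  then have "0 \<le> 2 * pi * (Re (U 0) - S)"
    by (simp add: algebra_simps)
  then show ?thesis
    using pi_gt_zero by (simp add: S_def zero_le_mult_iff)
qed

text \<open>Let \<open>r\<close> tend to 1 in the circle estimate while \<open>J\<close> stays
  fixed, then let \<open>J\<close> grow. All norm estimates for composition operators pass through
  this bound.\<close>

lemma H2_majorant:
  assumes f: "f holomorphic_on unit_disk" and U: "U holomorphic_on unit_disk"
    and le: "\<And>z. z \<in> unit_disk \<Longrightarrow> (cmod (f z))\<^sup>2 \<le> Re (U z)"
  shows "f \<in> H2" "H2_norm f \<le> sqrt (Re (U 0))"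
proof -
  have part: "(\<Sum>k<J. (cmod (taylor_coeff f k))\<^sup>2) \<le> Re (U 0)" for J
  proof -
    have "((\<lambda>r. \<Sum>k<J. (cmod (taylor_coeff f k))\<^sup>2 * r ^ (2*k)) \<longlongrightarrow>
        (\<Sum>k<J. (cmod (taylor_coeff f k))\<^sup>2 * 1 ^ (2*k))) (at_left (1::real))"
      by (intro tendsto_intros)
    moreover have "\<forall>\<^sub>F r in at_left (1::real). (\<Sum>k<J. (cmod (taylor_coeff f k))\<^sup>2 * r ^ (2*k)) \<le> Re (U 0)"
      using eventually_at_left_real[OF zero_less_one]
      by (rule eventually_mono) (use bessel_circle[OF f U le] in auto)
    ultimately show ?thesis
      by (intro tendsto_upperbound[where F = "at_left (1::real)"]) auto
  qed
  have sm: "summable (\<lambda>k. (cmod (taylor_coeff f k))\<^sup>2)"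
    by (rule summableI_nonneg_bounded[of _ "Re (U 0)"]) (use part in auto)
  then show "f \<in> H2"
    using f by (simp add: H2_def)
  have "(\<Sum>k. (cmod (taylor_coeff f k))\<^sup>2) \<le> Re (U 0)"
    by (rule suminf_le_const[OF sm part])
  then show "H2_norm f \<le> sqrt (Re (U 0))"
    by (simp add: H2_norm_def)
qed

text \<open>Cauchy-Schwarz on the blocks from \<open>n\<close> to \<open>m\<close>, with a geometric
  sum as second factor; then \<open>m\<close> tends to infinity.\<close>

lemma power_series_tail_Cauchy_Schwarz:
  fixes a :: "nat \<Rightarrow> complex"
  assumes sm: "summable (\<lambda>k. (cmod (a k))\<^sup>2)" and w: "cmod w < 1"
    and s: "(\<lambda>k. a k * w ^ k) sums S"
  shows "(cmod (S - (\<Sum>k<n. a k * w ^ k)))\<^sup>2 \<le>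
           (\<Sum>k. (cmod (a k))\<^sup>2) * ((cmod w) ^ (2*n) / (1 - (cmod w)\<^sup>2))"
proof -
  let ?A = "\<Sum>k. (cmod (a k))\<^sup>2" and ?q = "(cmod w) ^ (2*n) / (1 - (cmod w)\<^sup>2)"
  have w2: "(cmod w)\<^sup>2 < 1"
    using w by (simp add: power_less_one_iff)
  have A0: "0 \<le> ?A" by (rule suminf_nonneg[OF sm]) simp
  have fin: "(cmod (\<Sum>k=n..<m. a k * w ^ k))\<^sup>2 \<le> ?A * ?q" for m
  proof -
    have "(cmod (\<Sum>k=n..<m. a k * w ^ k))\<^sup>2 \<le> (\<Sum>k=n..<m. cmod (a k) * cmod w ^ k)\<^sup>2"
      by (rule power_mono, rule order_trans[OF norm_sum]) (auto simp: norm_mult norm_power)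
    also have "\<dots> \<le> (\<Sum>k=n..<m. (cmod (a k))\<^sup>2) * (\<Sum>k=n..<m. (cmod w ^ k)\<^sup>2)"
      by (rule Cauchy_Schwarz_ineq_sum)
    also have "\<dots> \<le> ?A * ?q"
    proof (rule mult_mono)
      show "(\<Sum>k=n..<m. (cmod (a k))\<^sup>2) \<le> ?A"
        by (rule sum_le_suminf[OF sm]) auto
      have g: "(\<lambda>k. (cmod w ^ 2) ^ k) sums (1 / (1 - (cmod w)\<^sup>2))"
        by (rule geometric_sums) (use w2 in simp)
      have g': "(\<lambda>k. (cmod w) ^ (2*n) * (cmod w ^ 2) ^ k) sums ?q"
        using sums_mult[OF g, of "(cmod w) ^ (2*n)"] by simp
      have "(\<Sum>k=n..<m. (cmod w ^ k)\<^sup>2) = (\<Sum>k<m-n. (cmod w) ^ (2*n) * (cmod w ^ 2) ^ k)"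
      proof (rule sum.reindex_bij_witness[of _ "\<lambda>k. k + n" "\<lambda>k. k - n"])
        fix k assume "k \<in> {n..<m}"
        then have "2 * k = 2 * n + 2 * (k - n)" by auto
        then show "(cmod w) ^ (2*n) * (cmod w ^ 2) ^ (k - n) = (cmod w ^ k)\<^sup>2"
          by (metis power_add power_mult mult.commute)
      qed auto
      also have "\<dots> \<le> ?q"
        using sum_le_suminf[OF sums_summable[OF g'], of "{..<m-n}"] sums_unique[OF g'] by simp
      finally show "(\<Sum>k=n..<m. (cmod w ^ k)\<^sup>2) \<le> ?q" .
    qed (use A0 in \<open>auto intro: sum_nonneg\<close>)
    finally show ?thesis .
  qed
  have "(\<lambda>m. \<Sum>k<m. a k * w ^ k) \<longlonglongrightarrow> S"
    using s by (simp add: sums_def)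
  then have "(\<lambda>m. (cmod ((\<Sum>k<m. a k * w ^ k) - (\<Sum>k<n. a k * w ^ k)))\<^sup>2)
      \<longlonglongrightarrow> (cmod (S - (\<Sum>k<n. a k * w ^ k)))\<^sup>2"
    by (intro tendsto_intros)
  moreover have "\<forall>\<^sub>F m in sequentially.
      (cmod ((\<Sum>k<m. a k * w ^ k) - (\<Sum>k<n. a k * w ^ k)))\<^sup>2 \<le> ?A * ?q"
  proof (rule eventually_sequentiallyI[of n])
    fix m assume "n \<le> m"
    then have "(\<Sum>k<m. a k * w ^ k) - (\<Sum>k<n. a k * w ^ k) = (\<Sum>k=n..<m. a k * w ^ k)"
      using sum_diff_nat_ivl[of 0 n m "\<lambda>k. a k * w ^ k"] by (simp add: lessThan_atLeast0)
    then show "(cmod ((\<Sum>k<m. a k * w ^ k) - (\<Sum>k<n. a k * w ^ k)))\<^sup>2 \<le> ?A * ?q"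
      using fin by simp
  qed
  ultimately show ?thesis
    by (intro tendsto_upperbound[where F = sequentially]) auto
qed

section \<open>Approximation numbers of composition operators\<close>

lemma H2_zero: "(\<lambda>z. 0) \<in> H2" "H2_norm (\<lambda>z. 0) = 0"
  by (auto simp: H2_def H2_norm_def taylor_coeff_def)

text \<open>The zero function lies in the unit ball and is sent to a function of norm 0. It serves
  as the test function because \<open>H2_norm\<close> has no known sign where the coefficients are
  not square summable.\<close>

lemma H2_opnorm_diff_nonneg:
  assumes "H2_linear_op R" "T (\<lambda>z. 0) = (\<lambda>z. 0)"
  shows "0 \<le> H2_opnorm (\<lambda>f z. T f z - R f z)"
proof -
  let ?o = "\<lambda>z::complex. 0::complex"
  \<comment> \<open>Linearity with coefficient 1 and zero arguments says that \<open>R ?o\<close>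
    equals its own double, hence vanishes.\<close>
  have "R (\<lambda>z. 1 * ?o z + ?o z) = (\<lambda>z. 1 * R ?o z + R ?o z)"
    using assms(1)[unfolded H2_linear_op_def, THEN conjunct2, rule_format, of ?o ?o 1] H2_zero by simp
  then have "R ?o = (\<lambda>z. R ?o z + R ?o z)" by simp
  then have "R ?o z = 0" for z
    by (metis add_cancel_right_right)
  then have "(\<lambda>z. T ?o z - R ?o z) = ?o"
    using assms(2) by simp
  then have "ereal (H2_norm (\<lambda>z. T ?o z - R ?o z)) = 0"
    using H2_zero by simp
  then show ?thesis
    unfolding H2_opnorm_def using H2_zero
    by (intro SUP_upper2[where i = ?o]) auto
qed

lemma approx_number_composition_nonneg: "0 \<le> approx_number (composition_op \<psi>) n"
  unfolding approx_number_def
  by (intro INF_greatest H2_opnorm_diff_nonneg) (auto simp: composition_op_def o_def)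

text \<open>The competitor \<open>R\<close> keeps the first \<open>n\<close> Taylor terms of
  \<open>f\<close> and composes with \<open>\<psi>\<close>. Its rank is at most \<open>n\<close>,
  whence the index \<open>Suc n\<close> for the strict bound in \<open>rank_less\<close>. The tail
  estimate makes \<open>Re U\<close> a harmonic majorant of the squared error for every
  \<open>f\<close> of norm at most 1.\<close>

lemma approx_number_composition_le:
  assumes \<psi>: "\<psi> holomorphic_on unit_disk" "\<psi> ` unit_disk \<subseteq> unit_disk"
    and U: "U holomorphic_on unit_disk"
    and le: "\<And>z. z \<in> unit_disk \<Longrightarrow> (cmod (\<psi> z)) ^ (2*n) / (1 - (cmod (\<psi> z))\<^sup>2) \<le> Re (U z)"
  shows "approx_number (composition_op \<psi>) (Suc n) \<le> ereal (sqrt (Re (U 0)))"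
proof -
  define R where "R f = (\<lambda>z. \<Sum>k<n. taylor_coeff f k * \<psi> z ^ k)" for f
  have \<psi>1: "cmod (\<psi> z) < 1" if "z \<in> unit_disk" for z
    using \<psi>(2) that by (metis image_subset_iff mem_ball_0)
  \<comment> \<open>A constant majorant suffices: since \<open>\<psi>\<close> stays in the disk,
    \<open>R f\<close> is bounded by the sum of the moduli of its coefficients.\<close>
  have RH2: "R f \<in> H2" if "f \<in> H2" for f
  proof (rule H2_majorant(1)[where U = "\<lambda>z. of_real ((\<Sum>k<n. cmod (taylor_coeff f k))\<^sup>2)"])
    show "R f holomorphic_on unit_disk"
      unfolding R_def by (intro holomorphic_intros \<psi>)
    fix z :: complex assume z: "z \<in> unit_disk"
    have "cmod (R f z) \<le> (\<Sum>k<n. cmod (taylor_coeff f k * \<psi> z ^ k))"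
      unfolding R_def by (rule norm_sum)
    also have "\<dots> \<le> (\<Sum>k<n. cmod (taylor_coeff f k) * 1)"
      unfolding norm_mult norm_power
      by (intro sum_mono mult_left_mono power_le_one) (use \<psi>1[OF z] in auto)
    finally show "(cmod (R f z))\<^sup>2 \<le> Re (of_real ((\<Sum>k<n. cmod (taylor_coeff f k))\<^sup>2))"
      by (simp del: of_real_power of_real_sum add: power_mono)
  qed auto
  have "H2_linear_op R"
    unfolding H2_linear_op_def
  proof (intro conjI ballI allI)
    fix f g and a :: complex assume "f \<in> H2" "g \<in> H2"
    then have "taylor_coeff (\<lambda>z. a * f z + g z) k = a * taylor_coeff f k + taylor_coeff g k" for k
      by (intro taylor_coeff_linear) (auto simp: H2_def)
    then show "R (\<lambda>z. a * f z + g z) = (\<lambda>z. a * R f z + R g z)"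
      by (simp add: R_def sum_distrib_left sum.distrib algebra_simps)
  qed (use RH2 in auto)
  moreover have "rank_less R (Suc n)"
    unfolding rank_less_def
  proof (intro exI[of _ "map (\<lambda>k z. \<psi> z ^ k) [0..<n]"] conjI ballI)
    fix f
    show "\<exists>c. R f = (\<lambda>z. \<Sum>i<length (map (\<lambda>k z. \<psi> z ^ k) [0..<n]). c i * (map (\<lambda>k z. \<psi> z ^ k) [0..<n] ! i) z)"
      by (rule exI[of _ "taylor_coeff f"]) (auto simp: R_def intro!: sum.cong)
  qed simp
  moreover have "H2_opnorm (\<lambda>f z. composition_op \<psi> f z - R f z) \<le> ereal (sqrt (Re (U 0)))"
    unfolding H2_opnorm_def
  proof (intro SUP_least)
    fix f assume "f \<in> {f \<in> H2. H2_norm f \<le> 1}"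
    then have f: "f holomorphic_on unit_disk" "summable (\<lambda>k. (cmod (taylor_coeff f k))\<^sup>2)" "H2_norm f \<le> 1"
      by (auto simp: H2_def)
    have f1: "(\<Sum>k. (cmod (taylor_coeff f k))\<^sup>2) \<le> 1"
      using f(3) by (simp add: H2_norm_def)
    have "H2_norm (\<lambda>z. composition_op \<psi> f z - R f z) \<le> sqrt (Re (U 0))"
    proof (rule H2_majorant(2)[OF _ U])
      have "(f \<circ> \<psi>) holomorphic_on unit_disk"
        using \<psi>(1) f(1) \<psi>(2) by (rule holomorphic_on_compose_gen)
      then show "(\<lambda>z. composition_op \<psi> f z - R f z) holomorphic_on unit_disk"
        unfolding R_def composition_op_def by (intro holomorphic_intros \<psi>)
      fix z assume z: "z \<in> unit_disk"
      have "(cmod (f (\<psi> z) - R f z))\<^sup>2 \<le> (\<Sum>k. (cmod (taylor_coeff f k))\<^sup>2) * ((cmod (\<psi> z)) ^ (2*n) / (1 - (cmod (\<psi> z))\<^sup>2))"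
        unfolding R_def
        by (rule power_series_tail_Cauchy_Schwarz[OF f(2) \<psi>1[OF z] taylor_coeff_sums[OF f(1)]])
           (use \<psi>1[OF z] in simp)
      also have "\<dots> \<le> 1 * ((cmod (\<psi> z)) ^ (2*n) / (1 - (cmod (\<psi> z))\<^sup>2))"
        using \<psi>1[OF z] by (intro mult_right_mono f1 divide_nonneg_nonneg) (auto simp: power_le_one)
      also have "\<dots> \<le> Re (U z)"
        using le[OF z] by simp
      finally show "(cmod (composition_op \<psi> f z - R f z))\<^sup>2 \<le> Re (U z)"
        by (simp add: composition_op_def)
    qed
    then show "ereal (H2_norm (\<lambda>z. composition_op \<psi> f z - R f z)) \<le> ereal (sqrt (Re (U 0)))"
      by simp
  qed
  ultimately show ?thesis
    unfolding approx_number_def by (intro INF_lower2[of R]) auto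
qed

text \<open>One fixed harmonic function, scaled by any negative power of \<open>n\<close>, majorizes
  the error, so the approximation numbers decay faster than every power. For given \<open>p\<close>
  a power \<open>N\<close> with \<open>N * p > 1\<close> yields summability.\<close>

lemma schatten_class_composition:
  assumes \<psi>: "\<psi> holomorphic_on unit_disk" "\<psi> ` unit_disk \<subseteq> unit_disk"
    and U: "U holomorphic_on unit_disk"
    and le: "\<And>N. \<exists>C\<ge>0. \<forall>n. \<forall>z\<in>unit_disk.
        (cmod (\<psi> z)) ^ (2*n) / (1 - (cmod (\<psi> z))\<^sup>2) \<le> C / real (Suc n) ^ N * Re (U z)"
    and p: "0 < p"
  shows "schatten_class p (composition_op \<psi>)"
proof -
  have bound: "\<exists>C\<ge>0. \<forall>n. approx_number (composition_op \<psi>) (Suc n) \<le> ereal (C / real (Suc n) ^ N)" for N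
  proof -
    \<comment> \<open>The exponent \<open>2*N\<close> becomes \<open>N\<close> after the square root
      in the norm bound.\<close>
    obtain C where C: "C \<ge> 0" "\<And>n z. z \<in> unit_disk \<Longrightarrow>
        (cmod (\<psi> z)) ^ (2*n) / (1 - (cmod (\<psi> z))\<^sup>2) \<le> C / real (Suc n) ^ (2*N) * Re (U z)"
      using le[of "2*N"] by blast
    have "approx_number (composition_op \<psi>) (Suc n) \<le> ereal (sqrt (C * \<bar>Re (U 0)\<bar>) / real (Suc n) ^ N)" for n
    proof -
      have "approx_number (composition_op \<psi>) (Suc n) \<le>
          ereal (sqrt (Re (of_real (C / real (Suc n) ^ (2*N)) * U 0)))"
        by (rule approx_number_composition_le[OF \<psi>])
           (use C U in \<open>auto intro!: holomorphic_intros simp del: of_real_divide of_real_power\<close>)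
      also have "sqrt (Re (of_real (C / real (Suc n) ^ (2*N)) * U 0)) =
          sqrt (C * Re (U 0)) / real (Suc n) ^ N"
      proof -
        have "sqrt (real (Suc n) ^ (2*N)) = real (Suc n) ^ N"
          by (rule real_sqrt_unique) (simp_all add: power_mult[symmetric] mult.commute)
        then show ?thesis
          by (simp add: real_sqrt_divide del: of_real_divide of_real_power of_nat_Suc)
      qed
      also have "\<dots> \<le> sqrt (C * \<bar>Re (U 0)\<bar>) / real (Suc n) ^ N"
        using C(1) by (intro divide_right_mono real_sqrt_le_mono mult_left_mono) auto
      finally show ?thesis by simp
    qed
    then show ?thesis
      using C(1) by (intro exI[of _ "sqrt (C * \<bar>Re (U 0)\<bar>)"]) auto
  qed
  define a where "a n = real_of_ereal (approx_number (composition_op \<psi>) n)" for n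
  have fin: "\<bar>approx_number (composition_op \<psi>) (Suc n)\<bar> \<noteq> \<infinity>" for n
    using bound[of 0] approx_number_composition_nonneg[of \<psi> "Suc n"]
    by (cases "approx_number (composition_op \<psi>) (Suc n)") (fastforce dest: spec[of _ n])+
  have aeq: "approx_number (composition_op \<psi>) n = ereal (a n)" if "n \<ge> 1" for n
    using fin[of "n - 1"] that by (simp add: a_def ereal_real)
  have a0: "0 \<le> a n" for n
    unfolding a_def by (simp add: real_of_ereal_pos approx_number_composition_nonneg)
  obtain N :: nat where N: "real N * p > 1"
    using p by (metis reals_Archimedean3)
  obtain C where C: "C \<ge> 0" "\<And>n. approx_number (composition_op \<psi>) (Suc n) \<le> ereal (C / real (Suc n) ^ N)"
    using bound[of N] by blast
  have "summable (\<lambda>n. a (Suc n) powr p)"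
  proof (rule summable_comparison_test')
    have "summable (\<lambda>n. real n powr (- (real N * p)))"
      using N by (simp add: summable_real_powr_iff)
    then have "summable (\<lambda>n. real (Suc n) powr (- (real N * p)))"
      by (subst summable_Suc_iff)
    then show "summable (\<lambda>n. C powr p * real (Suc n) powr (- (real N * p)))"
      by (rule summable_mult)
    fix n :: nat
    have "a (Suc n) \<le> C / real (Suc n) ^ N"
      using C(2)[of n] aeq[of "Suc n"] by simp
    then have "a (Suc n) powr p \<le> (C / real (Suc n) ^ N) powr p"
      using a0 p by (intro powr_mono2) auto
    also have "\<dots> = C powr p * real (Suc n) powr (- (real N * p))"
      using C(1) by (simp add: powr_divide powr_minus field_simps powr_realpow[symmetric] powr_powr del: of_nat_Suc)
    finally show "norm (a (Suc n) powr p) \<le> C powr p * real (Suc n) powr (- (real N * p))"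
      by simp
  qed
  then show ?thesis
    unfolding schatten_class_def using aeq by blast
qed


section \<open>The strip domain and its barrier\<close>

text \<open>The height \<open>4 * pi\<close> is two periods of \<open>exp\<close>: open sections of
  one period would miss points of the punctured disk, while two periods cover each point once or
  twice.\<close>

definition strip_domain :: "(real \<Rightarrow> real) \<Rightarrow> complex set" where
  "strip_domain H = {z. 0 < Re z \<and> H (Re z) < Im z \<and> Im z < H (Re z) + 4 * pi}"

text \<open>The vertical shear by \<open>H\<close> maps a convex half-strip homeomorphically onto
  the domain. Simple connectivity comes from convexity, openness from invariance of domain.\<close>

lemma strip_domain_open_simply_connected:
  assumes "continuous_on {0<..} H"
  shows "open (strip_domain H)" "simply_connected (strip_domain H)"
proof -
  define S where "S = {z. Re z > 0} \<inter> {z. Im z > 0} \<inter> {z. Im z < 4 * pi}"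
  define T where "T z = z + \<i> * of_real (H (Re z))" for z
  define T' where "T' z = z - \<i> * of_real (H (Re z))" for z
  have T: "T ` S = strip_domain H"
  proof
    show "strip_domain H \<subseteq> T ` S"
    proof
      fix z assume "z \<in> strip_domain H"
      then have "T' z \<in> S" "T (T' z) = z"
        by (auto simp: strip_domain_def S_def T_def T'_def)
      then show "z \<in> T ` S" by (metis image_eqI)
    qed
  qed (auto simp: strip_domain_def S_def T_def)
  have conv: "convex S"
    unfolding S_def by (intro convex_Int convex_halfspace_Re_gt convex_halfspace_Im_gt convex_halfspace_Im_lt)
  have "open S"
    unfolding S_def by (intro open_Int open_halfspace_Re_gt open_halfspace_Im_gt open_halfspace_Im_lt)
  have cS: "continuous_on A (\<lambda>z. H (Re z))" if "A \<subseteq> {z. 0 < Re z}" for A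
    by (rule continuous_on_compose2[OF assms]) (use that in \<open>auto intro!: continuous_intros\<close>)
  have cT: "continuous_on S T"
    unfolding T_def by (intro continuous_intros cS) (auto simp: S_def)
  have cT': "continuous_on (strip_domain H) T'"
    unfolding T'_def by (intro continuous_intros cS) (auto simp: strip_domain_def)
  have T'T: "T' (T z) = z" for z
    by (auto simp: T_def T'_def)
  have TT': "T (T' z) = z" for z
    by (auto simp: T_def T'_def)
  have "inj T" by (metis T'T injI)
  show "open (strip_domain H)"
    using invariance_of_domain[OF cT \<open>open S\<close>] inj_on_subset[OF \<open>inj T\<close>] T by auto
  have "S homeomorphic strip_domain H"
    unfolding homeomorphic_def homeomorphism_def
  proof (rule exI[of _ T], rule exI[of _ T'], intro conjI ballI)
    show "T' ` strip_domain H = S"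
      unfolding T[symmetric] image_image T'T by simp
  qed (use T cT cT' T'T TT' in auto)
  then show "simply_connected (strip_domain H)"
    using convex_imp_simply_connected[OF conv] homeomorphic_simply_connected by blast
qed

lemma strip_domain_Riemann_map:
  assumes "continuous_on {0<..} H"
  obtains g where "g holomorphic_on unit_disk" "inj_on g unit_disk" "g ` unit_disk = strip_domain H"
proof -
  let ?S = "strip_domain H"
  have "Complex 1 (H 1 + 1) \<in> ?S"
    using pi_gt3 by (simp add: strip_domain_def)
  moreover have "0 \<notin> ?S" by (simp add: strip_domain_def)
  ultimately have "?S \<noteq> {}" "?S \<noteq> UNIV" by blast+
  then obtain f g where fg: "g holomorphic_on ball 0 1"
      "\<forall>z \<in> ?S. f z \<in> ball 0 1 \<and> g (f z) = z" "\<forall>z \<in> ball 0 1. g z \<in> ?S \<and> f (g z) = z"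
    using Riemann_mapping_theorem[of ?S] strip_domain_open_simply_connected[OF assms] by blast
  show ?thesis
  proof
    show "inj_on g unit_disk" using fg(3) by (metis inj_onI)
    show "g ` unit_disk = ?S" using fg(2,3) by (metis image_eqI subsetI subset_antisym image_subset_iff)
  qed (rule fg)
qed

lemma strip_domain_exp_image: "(\<lambda>v. exp (- v)) ` strip_domain H = unit_disk - {0}"
proof
  show "(\<lambda>v. exp (- v)) ` strip_domain H \<subseteq> unit_disk - {0}"
    by (auto simp: strip_domain_def)
  show "unit_disk - {0} \<subseteq> (\<lambda>v. exp (- v)) ` strip_domain H"
  proof
    fix w :: complex assume "w \<in> unit_disk - {0}"
    then have w: "w \<noteq> 0" "cmod w < 1" by auto
    define x where "x = Re (- Ln w)"
    have x: "x > 0" using w by (simp add: x_def)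
    \<comment> \<open>The least shift by whole periods that lifts \<open>- Ln w\<close> strictly
      above the lower edge. It overshoots by at most \<open>2 * pi\<close>, so the upper edge is not
      reached.\<close>
    define n where "n = \<lfloor>(H x - Im (- Ln w)) / (2 * pi)\<rfloor> + 1"
    define v where "v = - Ln w + \<i> * of_real (2 * pi * of_int n)"
    have "(H x - Im (- Ln w)) / (2 * pi) < of_int n" "of_int n \<le> (H x - Im (- Ln w)) / (2 * pi) + 1"
      unfolding n_def by linarith+
    then have "H x - Im (- Ln w) < 2 * pi * of_int n" "2 * pi * of_int n \<le> H x - Im (- Ln w) + 2 * pi"
      by (simp_all add: field_simps)
    then have "v \<in> strip_domain H"
      using x pi_gt_zero unfolding strip_domain_def v_def x_def[symmetric] mem_Collect_eq
      by (simp add: x_def)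
    moreover have "exp (- v) = w"
    proof -
      have "exp (- v) = exp (Ln w)"
        unfolding exp_eq by (rule exI[of _ "- n"]) (simp add: v_def algebra_simps)
      then show ?thesis using w by simp
    qed
    ultimately show "w \<in> (\<lambda>v. exp (- v)) ` strip_domain H" by (metis image_eqI)
  qed
qed

text \<open>Preimages of one point share their real part and differ by whole periods. Counted from
  \<open>v0\<close>, the lower edge lies at \<open>a\<close> periods and the upper one at
  \<open>a + 2\<close>, which leaves at most two integers strictly between.\<close>

lemma strip_domain_exp_valence:
  "finite {v \<in> strip_domain H. exp (- v) = w} \<and> card {v \<in> strip_domain H. exp (- v) = w} \<le> 2"
proof (cases "{v \<in> strip_domain H. exp (- v) = w} = {}")
  case False
  then obtain v0 where v0: "v0 \<in> strip_domain H" "exp (- v0) = w" by blast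
  define a where "a = (H (Re v0) - Im v0) / (2 * pi)"
  define V where "V n = v0 + of_real (2 * pi * of_int n) * \<i>" for n
  have "{v \<in> strip_domain H. exp (- v) = w} \<subseteq> {V (\<lfloor>a\<rfloor> + 1), V (\<lfloor>a\<rfloor> + 2)}"
  proof
    fix v assume "v \<in> {v \<in> strip_domain H. exp (- v) = w}"
    then have v: "v \<in> strip_domain H" "exp (- v) = exp (- v0)" using v0 by auto
    then obtain n where "- v0 = - v + (of_int (2 * n) * pi) * \<i>"
      using exp_eq[of "- v0" "- v"] by auto
    then have n: "v = V n"
      by (simp add: V_def algebra_simps)
    have "H (Re v0) < Im v0 + 2 * pi * of_int n" "Im v0 + 2 * pi * of_int n < H (Re v0) + 4 * pi"
      using v(1) by (auto simp: n V_def strip_domain_def)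
    then have "a < of_int n" "of_int n < a + 2"
      by (simp_all add: a_def field_simps)
    then have "n = \<lfloor>a\<rfloor> + 1 \<or> n = \<lfloor>a\<rfloor> + 2" by linarith
    then show "v \<in> {V (\<lfloor>a\<rfloor> + 1), V (\<lfloor>a\<rfloor> + 2)}" using n by auto
  qed
  then have "card {v \<in> strip_domain H. exp (- v) = w} \<le> card {V (\<lfloor>a\<rfloor> + 1), V (\<lfloor>a\<rfloor> + 2)}"
      "finite {v \<in> strip_domain H. exp (- v) = w}"
    by (auto intro: card_mono finite_subset)
  moreover have "card {V (\<lfloor>a\<rfloor> + 1), V (\<lfloor>a\<rfloor> + 2)} \<le> 2"
    by (simp add: card_insert_if)
  ultimately show ?thesis by simp
next
  case True
  then show ?thesis by (simp only: finite.emptyI card.empty) simp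
qed

lemma p_valent_exp_strip:
  assumes "inj_on g unit_disk" "g ` unit_disk = strip_domain H"
  shows "p_valent 2 (\<lambda>z. exp (- g z))"
  unfolding p_valent_def
proof
  fix w
  let ?A = "{z \<in> unit_disk. exp (- g z) = w}" and ?B = "{v \<in> strip_domain H. exp (- v) = w}"
  have "g ` ?A \<subseteq> ?B" "inj_on g ?A" using assms by (auto simp: inj_on_def)
  then show "finite ?A \<and> card ?A \<le> 2"
    using strip_domain_exp_valence[of H w]
    by (meson card_inj_on_le finite_imageD finite_subset le_trans)
qed

lemma image_exp_strip:
  assumes "g ` unit_disk = strip_domain H"
  shows "(\<lambda>z. exp (- g z)) ` unit_disk = unit_disk - {0}"
proof -
  have "(\<lambda>z. exp (- g z)) ` unit_disk = (\<lambda>v. exp (- v)) ` (g ` unit_disk)"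
    by (simp add: image_image)
  then show ?thesis by (simp add: assms strip_domain_exp_image)
qed

text \<open>The exponential term has large positive real part far up in the vertical end of the domain;
  its negative values occur only where the imaginary part is below \<open>4 * pi\<close>, and the constant
  compensates for them. The linear term makes the real part tend to infinity at infinity.\<close>

definition strip_barrier :: "complex \<Rightarrow> complex" where
  "strip_barrier z = of_real (exp (4 * pi) + 1) + z + exp (- \<i> * z)"

lemma strip_barrier_holomorphic [holomorphic_intros]:
  "g holomorphic_on A \<Longrightarrow> (\<lambda>z. strip_barrier (g z)) holomorphic_on A"
  unfolding strip_barrier_def by (intro holomorphic_intros)

lemma Re_strip_barrier:
  "Re (strip_barrier z) = exp (4 * pi) + 1 + Re z + exp (Im z) * cos (Re z)"
  by (simp add: strip_barrier_def Re_exp)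

text \<open>For \<open>Re z < 1\<close> the cosine is at least \<open>1/2\<close> because
  \<open>1 < pi / 3\<close>. For \<open>Re z \<ge> 1\<close> the function \<open>H\<close> vanishes,
  so \<open>Im z < 4 * pi\<close> and the constant in the barrier absorbs the exponential
  term.\<close>

lemma strip_barrier_ge:
  assumes z: "z \<in> strip_domain H" and H: "\<And>x. 1 \<le> x \<Longrightarrow> H x = 0"
  shows "Re (strip_barrier z) \<ge> 1 + Re z"
    and "Re z < 1 \<or> 4 * pi \<le> Im z \<Longrightarrow> Re (strip_barrier z) \<ge> 1 + Re z + exp (Im z) / 2"
proof -
  have x: "Re z > 0" using z by (simp add: strip_domain_def)
  have *: "Re (strip_barrier z) \<ge> 1 + Re z + exp (Im z) / 2" if "Re z < 1"
  proof -
    have "cos (pi / 3) \<le> cos (Re z)"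
      using that x pi_gt3 by (intro cos_monotone_0_pi_le) auto
    then have "exp (Im z) * (1/2) \<le> exp (Im z) * cos (Re z)"
      by (intro mult_left_mono) (auto simp: cos_60)
    then show ?thesis
      by (simp add: Re_strip_barrier add_increasing)
  qed
  have **: "Re (strip_barrier z) \<ge> 1 + Re z \<and> Im z < 4 * pi" if "Re z \<ge> 1"
  proof -
    have i: "Im z < 4 * pi" using z H[OF that] by (simp add: strip_domain_def)
    have "exp (Im z) * (-1) \<le> exp (Im z) * cos (Re z)"
      by (intro mult_left_mono) auto
    moreover have "exp (Im z) \<le> exp (4 * pi)" using i by simp
    ultimately have "- exp (4 * pi) \<le> exp (Im z) * cos (Re z)" by linarith
    then show ?thesis using i by (simp add: Re_strip_barrier)
  qed
  show "Re (strip_barrier z) \<ge> 1 + Re z"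
    using * ** by (smt (verit) exp_gt_zero half_gt_zero)
  show "Re (strip_barrier z) \<ge> 1 + Re z + exp (Im z) / 2" if "Re z < 1 \<or> 4 * pi \<le> Im z"
    using * ** that by linarith
qed


section \<open>Radial limits of bounded univalent functions\<close>

text \<open>Fubini is applied on \<open>real \<times> real\<close>, the Jacobian formula on
  \<open>real ^ 2\<close>; this linear map connects the two.\<close>

definition vec_of_pair :: "real \<times> real \<Rightarrow> real ^ 2" where
  "vec_of_pair p = vector [fst p, snd p]"

lemma vec_of_pair_nth [simp]: "vec_of_pair p $ 1 = fst p" "vec_of_pair p $ 2 = snd p"
  by (simp_all add: vec_of_pair_def)

lemma bounded_linear_vec_of_pair: "bounded_linear vec_of_pair"
  by (simp add: linear_conv_bounded_linear[symmetric])
     (rule linearI; simp add: vec_eq_iff forall_2)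

lemma prod_Basis_vec2: "(\<Prod>b\<in>(Basis :: (real ^ 2) set). v \<bullet> b) = v $ 1 * v $ 2"
proof -
  have B: "(Basis :: (real ^ 2) set) = {axis 1 1, axis 2 1}"
    by (auto simp: Basis_vec_def UNIV_2)
  have "axis 1 1 \<noteq> (axis 2 1 :: real ^ 2)"
    by (simp add: axis_eq_axis)
  then show ?thesis
    unfolding B by (simp add: inner_axis)
qed

text \<open>Both measures give a box the product of its side lengths, which determines Lebesgue
  measure.\<close>

lemma distr_vec_of_pair: "distr lborel borel vec_of_pair = lborel"
proof (rule lborel_eqI[symmetric])
  have meas [measurable]: "vec_of_pair \<in> borel_measurable borel"
    by (intro borel_measurable_continuous_onI linear_continuous_on bounded_linear_vec_of_pair)
  fix l u :: "real ^ 2" assume le: "\<And>b. b \<in> Basis \<Longrightarrow> l \<bullet> b \<le> u \<bullet> b"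
  have le': "l $ i \<le> u $ i" for i
    using le[of "axis i 1"] by (simp add: inner_axis axis_in_Basis_iff)
  have "vec_of_pair -` box l u = {(l $ 1)<..<(u $ 1)} \<times> {(l $ 2)<..<(u $ 2)}"
    by (auto simp: mem_box_cart forall_2)
  then have "emeasure (distr lborel borel vec_of_pair) (box l u) =
      emeasure (lborel \<Otimes>\<^sub>M lborel) ({(l $ 1)<..<(u $ 1)} \<times> {(l $ 2)<..<(u $ 2)})"
    by (simp add: emeasure_distr lborel_prod)
  also have "\<dots> = ennreal (u $ 1 - l $ 1) * ennreal (u $ 2 - l $ 2)"
    using le' by (simp add: lborel.emeasure_pair_measure_Times)
  also have "\<dots> = ennreal (\<Prod>b\<in>Basis. (u - l) \<bullet> b)"
    using le' by (simp add: prod_Basis_vec2 ennreal_mult)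
  finally show "emeasure (distr lborel borel vec_of_pair) (box l u) = (\<Prod>b\<in>Basis. (u - l) \<bullet> b)"
    .
qed simp

definition complex_of_vec :: "real ^ 2 \<Rightarrow> complex" where
  "complex_of_vec x = Complex (x $ 1) (x $ 2)"

definition vec_of_complex :: "complex \<Rightarrow> real ^ 2" where
  "vec_of_complex z = vec_of_pair (Re z, Im z)"

lemma bounded_linear_complex_of_vec: "bounded_linear complex_of_vec"
  by (simp add: linear_conv_bounded_linear[symmetric])
     (rule linearI; simp add: complex_of_vec_def complex_eq_iff)

lemma bounded_linear_vec_of_complex: "bounded_linear vec_of_complex"
  by (simp add: linear_conv_bounded_linear[symmetric])
     (rule linearI; simp add: vec_of_complex_def vec_eq_iff forall_2)

lemma complex_of_vec_inverse [simp]: "complex_of_vec (vec_of_complex z) = z"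
  by (simp add: complex_of_vec_def vec_of_complex_def)

lemma vec_of_complex_inverse [simp]: "vec_of_complex (complex_of_vec x) = x"
  by (simp add: complex_of_vec_def vec_of_complex_def vec_eq_iff forall_2)

text \<open>Multiplication by \<open>a + b * \<i>\<close> has the matrix with rows
  \<open>a, -b\<close> and \<open>b, a\<close>. This is the Jacobian of a holomorphic map with
  derivative \<open>c\<close>.\<close>

lemma det_matrix_complex_mult:
  "det (matrix (\<lambda>h. vec_of_complex (c * complex_of_vec h))) = (cmod c)\<^sup>2"
  by (simp add: det_2 matrix_def vec_of_complex_def complex_of_vec_def axis_def cmod_power2 flip: power2_eq_square)

lemma has_derivative_vec_conjugate:
  assumes "(G has_field_derivative G') (at (complex_of_vec x))"
  shows "((\<lambda>x. vec_of_complex (G (complex_of_vec x))) has_derivative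
           (\<lambda>h. vec_of_complex (G' * complex_of_vec h))) (at x)"
proof -
  have "((\<lambda>x. G (complex_of_vec x)) has_derivative (\<lambda>h. G' * complex_of_vec h)) (at x)"
    using has_derivative_compose[OF bounded_linear_imp_has_derivative[OF bounded_linear_complex_of_vec]
        assms[unfolded has_field_derivative_def]] by simp
  then show ?thesis
    by (rule bounded_linear.has_derivative[OF bounded_linear_vec_of_complex])
qed

text \<open>By change of variables the integral is the area of the image of \<open>W\<close>, an
  open bounded set.\<close>

lemma univalent_finite_dirichlet:
  assumes G: "\<And>w. w \<in> W \<Longrightarrow> (G has_field_derivative G' w) (at w)"
    and W: "open W" and cont: "continuous_on W G'"
    and inj: "inj_on G W" and bdd: "bounded (G ` W)"
  shows "integrable lborel (\<lambda>(u, t). indicator W (Complex u t) * (cmod (G' (Complex u t)))\<^sup>2)"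
proof -
  define S where "S = complex_of_vec -` W"
  define \<gamma> where "\<gamma> = (\<lambda>x. vec_of_complex (G (complex_of_vec x)))"
  have "open S"
    unfolding S_def
    by (intro open_vimage W linear_continuous_on bounded_linear_complex_of_vec)
  have der: "(\<gamma> has_derivative (\<lambda>h. vec_of_complex (G' (complex_of_vec x) * complex_of_vec h))) (at x)"
    if "x \<in> S" for x
    unfolding \<gamma>_def by (rule has_derivative_vec_conjugate[OF G]) (use that in \<open>simp add: S_def\<close>)
  have injS: "inj_on \<gamma> S"
  proof (rule inj_onI)
    fix x y assume xy: "x \<in> S" "y \<in> S" "\<gamma> x = \<gamma> y"
    then have "G (complex_of_vec x) = G (complex_of_vec y)"
      unfolding \<gamma>_def by (metis complex_of_vec_inverse)
    then have "complex_of_vec x = complex_of_vec y"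
      using xy inj by (auto simp: S_def inj_on_def)
    then show "x = y" by (metis vec_of_complex_inverse)
  qed
  have "continuous_on S \<gamma>"
    by (rule has_derivative_continuous_on[OF has_derivative_at_withinI[OF der]])
  then have op: "open (\<gamma> ` S)"
    by (rule invariance_of_domain[OF _ \<open>open S\<close> injS])
  have "\<gamma> ` S \<subseteq> vec_of_complex ` (G ` W)"
    by (auto simp: \<gamma>_def S_def)
  then have "bounded (\<gamma> ` S)"
    using bounded_linear_image[OF bdd bounded_linear_vec_of_complex] bounded_subset by blast
  then have "\<gamma> ` S \<in> lmeasurable"
    using op by (rule lmeasurable_open)
  \<comment> \<open>The constant 1 takes values in \<open>real ^ 1\<close> to fit the vector-valued
    change of variables; the component along \<open>axis 1 1\<close> later recovers a real
    integrand.\<close>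
  then have i1: "(\<lambda>x. 1 :: real ^ 1) absolutely_integrable_on \<gamma> ` S"
    by (rule absolutely_integrable_on_const)
  have Sl: "S \<in> sets lebesgue"
    using \<open>open S\<close> by simp
  have "(\<lambda>x. \<bar>det (matrix (\<lambda>h. vec_of_complex (G' (complex_of_vec x) * complex_of_vec h)))\<bar> *\<^sub>R (1 :: real ^ 1))
      absolutely_integrable_on S"
    using absolutely_integrable_change_of_variables[where f = "\<lambda>x. 1 :: real ^ 1",
        OF Sl has_derivative_at_withinI[OF der] injS] i1 by (rule iffD1)
  then have "(\<lambda>x. (\<bar>det (matrix (\<lambda>h. vec_of_complex (G' (complex_of_vec x) * complex_of_vec h)))\<bar> *\<^sub>R (1 :: real ^ 1)) \<bullet> axis 1 1)
      absolutely_integrable_on S"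
    by (rule absolutely_integrable_component)
  then have "(\<lambda>x. (cmod (G' (complex_of_vec x)))\<^sup>2) absolutely_integrable_on S"
    by (simp add: det_matrix_complex_mult inner_axis)
  then have "integrable lebesgue (\<lambda>x. indicator S x *\<^sub>R (cmod (G' (complex_of_vec x)))\<^sup>2)"
    by (simp add: set_integrable_def)
  \<comment> \<open>Borel measurability allows the return from the completed measure to
    \<open>lborel\<close>.\<close>
  moreover have meas: "(\<lambda>x. indicator S x *\<^sub>R (cmod (G' (complex_of_vec x)))\<^sup>2) \<in> borel_measurable borel"
  proof (rule borel_measurable_continuous_on_indicator)
    have "continuous_on S (\<lambda>x. G' (complex_of_vec x))"
      by (rule continuous_on_compose2[OF cont linear_continuous_on[OF bounded_linear_complex_of_vec]])
         (auto simp: S_def)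
    then show "continuous_on S (\<lambda>x. (cmod (G' (complex_of_vec x)))\<^sup>2)"
      by (intro continuous_intros)
    show "S \<in> sets borel" using \<open>open S\<close> by simp
  qed
  ultimately have "integrable lborel (\<lambda>x. indicator S x *\<^sub>R (cmod (G' (complex_of_vec x)))\<^sup>2)"
    by (simp add: integrable_completion)
  then have "integrable (distr lborel borel vec_of_pair) (\<lambda>x. indicator S x *\<^sub>R (cmod (G' (complex_of_vec x)))\<^sup>2)"
    by (simp add: distr_vec_of_pair)
  then have "integrable lborel (\<lambda>p. indicator S (vec_of_pair p) *\<^sub>R (cmod (G' (complex_of_vec (vec_of_pair p))))\<^sup>2)"
  proof (rule integrable_distr[rotated])
    show "vec_of_pair \<in> measurable lborel borel"
      by (simp add: borel_measurable_continuous_onI linear_continuous_on bounded_linear_vec_of_pair)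
  qed
  moreover have "indicator S (vec_of_pair p) *\<^sub>R (cmod (G' (complex_of_vec (vec_of_pair p))))\<^sup>2 =
      (case p of (u, t) \<Rightarrow> indicator W (Complex u t) * (cmod (G' (Complex u t)))\<^sup>2)" for p
    by (cases p) (simp add: S_def complex_of_vec_def indicator_def)
  ultimately show ?thesis by simp
qed

text \<open>On an interval of finite length \<open>\<bar>k\<bar> \<le> 1 + \<bar>k\<bar>^2\<close>
  turns square integrability into integrability, and \<open>K\<close> differs by a constant from an
  indefinite integral that is continuous up to 0.\<close>

lemma integrable_derivative_has_limit:
  fixes k K :: "real \<Rightarrow> complex"
  assumes K: "\<And>u. -1 < u \<Longrightarrow> u < 0 \<Longrightarrow> (K has_vector_derivative k u) (at u)"
    and cont: "continuous_on {-1<..<0} k"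
    and int: "integrable lborel (\<lambda>u. indicator {-1<..<0} u * (cmod (k u))\<^sup>2)"
  shows "\<exists>l. (K \<longlongrightarrow> l) (at_left 0)"
proof -
  have "(\<lambda>u. indicator {-1<..<0} u *\<^sub>R k u) \<in> borel_measurable borel"
    by (rule borel_measurable_continuous_on_indicator[OF _ cont]) simp
  moreover have "integrable lborel (\<lambda>u. indicator {-1<..<0} u + indicator {-1<..<0} u * (cmod (k u))\<^sup>2)"
    by (intro Bochner_Integration.integrable_add int) simp
  moreover have "norm (indicator {-1<..<0} u *\<^sub>R k u) \<le>
      norm (indicator {-1<..<0} u + indicator {-1<..<0} u * (cmod (k u))\<^sup>2 :: real)" for u
  proof -
    have "2 * cmod (k u) \<le> 1 + (cmod (k u))\<^sup>2"
      using sum_squares_bound[of 1 "cmod (k u)"] by simp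
    then have "cmod (k u) \<le> 1 + (cmod (k u))\<^sup>2"
      by (smt (verit) norm_ge_zero)
    then show ?thesis by (auto simp: indicator_def)
  qed
  ultimately have "integrable lborel (\<lambda>u. indicator {-1<..<0} u *\<^sub>R k u)"
    by (intro Bochner_Integration.integrable_bound[where g = "\<lambda>u. indicator {-1<..<0} u *\<^sub>R k u"]) auto
  then have "integrable lebesgue (\<lambda>u. indicator {-1<..<0} u *\<^sub>R k u)"
    by (simp add: integrable_completion borel_measurable_integrable)
  then have "k absolutely_integrable_on {-1<..<0}"
    by (simp add: set_integrable_def)
  then have "k integrable_on {-1..0}"
    by (simp add: set_lebesgue_integral_eq_integral(1) integrable_on_Icc_iff_Ioo)
  \<comment> \<open>The base point \<open>-1/2\<close> is interior, so \<open>K\<close> is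
    differentiable on all of \<open>{-1/2..u}\<close> for \<open>u < 0\<close>.\<close>
  then have ki: "k integrable_on {-1/2..0}"
    by (rule integrable_on_subinterval) auto
  define I where "I u = integral {-1/2..u} k" for u
  have "continuous_on {-1/2..0} I"
    unfolding I_def by (rule indefinite_integral_continuous_1[OF ki])
  then have "(I \<longlongrightarrow> I 0) (at 0 within {-1/2..0})"
    by (auto simp: continuous_on_def)
  then have "(I \<longlongrightarrow> I 0) (at_left 0)"
    by (simp add: at_within_Icc_at_left)
  then have "((\<lambda>u. K (-1/2) + I u) \<longlongrightarrow> K (-1/2) + I 0) (at_left 0)"
    by (intro tendsto_intros)
  moreover have "\<forall>\<^sub>F u in at_left 0. K (-1/2) + I u = K u"
  proof -
    have "\<forall>\<^sub>F u in at_left 0. u \<in> {-1/2<..<0::real}"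
      by (rule eventually_at_left_real) simp
    then show ?thesis
    proof eventually_elim
      case (elim u)
      have "(k has_integral (K u - K (-1/2))) {-1/2..u}"
      proof (rule fundamental_theorem_of_calculus)
        show "(K has_vector_derivative k x) (at x within {-1/2..u})" if "x \<in> {-1/2..u}" for x
          by (rule has_vector_derivative_at_within[OF K]) (use that elim in auto)
      qed (use elim in simp)
      then show ?case by (simp add: I_def integral_unique)
    qed
  qed
  ultimately show ?thesis
    by (intro exI) (rule Lim_transform_eventually)
qed

lemma bounded_univalent_radial_limit:
  assumes f: "f holomorphic_on unit_disk" "inj_on f unit_disk" "bounded (f ` unit_disk)"
  shows "AE t in lborel. t \<in> {0<..<2*pi} \<longrightarrow> (\<exists>l. ((\<lambda>r. f (of_real r * cis t)) \<longlongrightarrow> l) (at_left 1))"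
proof -
  \<comment> \<open>In logarithmic coordinates the radii become horizontal segments, and the conformality of
    \<open>f \<circ> exp\<close> makes the squared radial derivative equal to the Jacobian.\<close>
  define W where "W = {w. -1 < Re w} \<inter> {w. Re w < 0} \<inter> {w. 0 < Im w} \<inter> {w. Im w < 2 * pi}"
  define G where "G w = f (exp w)" for w
  define G' where "G' w = deriv f (exp w) * exp w" for w
  have W_iff: "Complex u t \<in> W \<longleftrightarrow> u \<in> {-1<..<0} \<and> t \<in> {0<..<2*pi}" for u t
    by (auto simp: W_def)
  have W: "open W"
    unfolding W_def by (intro open_Int open_halfspace_Re_gt open_halfspace_Re_lt open_halfspace_Im_gt open_halfspace_Im_lt)
  have expW: "exp w \<in> unit_disk" if "w \<in> W" for w
    using that by (auto simp: W_def)
  have der: "(G has_field_derivative G' w) (at w)" if "w \<in> W" for w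
    unfolding G_def G'_def
    by (rule DERIV_chain2[of f]) (use expW[OF that] f(1) holomorphic_derivI in \<open>auto intro!: DERIV_exp\<close>)
  have cont: "continuous_on W G'"
  proof -
    have "continuous_on unit_disk (deriv f)"
      using f(1) by (intro holomorphic_on_imp_continuous_on holomorphic_deriv) auto
    then have "continuous_on W (\<lambda>w. deriv f (exp w))"
      by (rule continuous_on_compose2) (use expW in \<open>auto intro!: continuous_intros\<close>)
    then show ?thesis
      unfolding G'_def by (intro continuous_intros)
  qed
  \<comment> \<open>The open rectangle has height \<open>2 * pi\<close>, so \<open>exp\<close>
    covers a slit annulus only once.\<close>
  have "inj_on exp W"
  proof (rule inj_onI)
    fix v w assume vw: "v \<in> W" "w \<in> W" "exp v = exp w"
    then have "\<bar>Im v - Im w\<bar> < 2 * pi" by (auto simp: W_def)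
    then show "v = w" using vw(3) by (rule exp_complex_eqI)
  qed
  then have inj: "inj_on G W"
    using f(2) expW unfolding G_def inj_on_def by metis
  have bdd: "bounded (G ` W)"
    using expW by (intro bounded_subset[OF f(3)]) (auto simp: G_def simp del: mem_ball_0)
  have "integrable (lborel \<Otimes>\<^sub>M lborel) (\<lambda>(u, t). indicator W (Complex u t) * (cmod (G' (Complex u t)))\<^sup>2)"
    using univalent_finite_dirichlet[OF der W cont inj bdd] by (simp add: lborel_prod)
  \<comment> \<open>Fubini: for almost every angle \<open>t\<close> the squared derivative is
    integrable in the logarithm \<open>u\<close> of the radius.\<close>
  then have "AE t in lborel. integrable lborel (\<lambda>u. indicator W (Complex u t) * (cmod (G' (Complex u t)))\<^sup>2)"
    by (rule lborel_pair.AE_integrable_snd)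
  then show ?thesis
  proof eventually_elim
    case (elim t)
    show ?case
    proof
      assume t: "t \<in> {0<..<2*pi}"
      have Wt: "Complex u t \<in> W" if "-1 < u" "u < 0" for u
        using that t by (simp add: W_iff)
      have "\<exists>l. ((\<lambda>u. G (Complex u t)) \<longlongrightarrow> l) (at_left 0)"
      proof (rule integrable_derivative_has_limit)
        show "((\<lambda>u. G (Complex u t)) has_vector_derivative G' (Complex u t)) (at u)" if "-1 < u" "u < 0" for u
        proof -
          have "((\<lambda>u. Complex u t) has_vector_derivative 1) (at u)"
            unfolding Complex_eq by (auto intro!: derivative_eq_intros)
          from field_vector_diff_chain_at[OF this der[OF Wt[OF that]]] show ?thesis
            by (simp add: o_def)
        qed
        show "continuous_on {-1<..<0} (\<lambda>u. G' (Complex u t))"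
          by (rule continuous_on_compose2[OF cont])
             (use Wt in \<open>auto simp: Complex_eq intro!: continuous_intros\<close>)
        have "(\<lambda>u. indicator W (Complex u t) * (cmod (G' (Complex u t)))\<^sup>2) =
            (\<lambda>u. indicator {-1<..<0} u * (cmod (G' (Complex u t)))\<^sup>2)"
          using t by (auto simp: indicator_def W_iff)
        then show "integrable lborel (\<lambda>u. indicator {-1<..<0} u * (cmod (G' (Complex u t)))\<^sup>2)"
          using elim by simp
      qed
      then obtain l where l: "((\<lambda>u. G (Complex u t)) \<longlongrightarrow> l) (at_left 0)" by blast
      have "filterlim (ln :: real \<Rightarrow> real) (at_left 0) (at_left 1)"
        unfolding filterlim_at
      proof
        have "((ln :: real \<Rightarrow> real) \<longlongrightarrow> ln 1) (at_left 1)"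
          by (intro tendsto_intros) auto
        then show "((ln :: real \<Rightarrow> real) \<longlongrightarrow> 0) (at_left 1)" by simp
        show "\<forall>\<^sub>F x in at_left 1. ln x \<in> {..<0::real} \<and> ln x \<noteq> 0"
          using eventually_at_left_real[OF zero_less_one] by (rule eventually_mono) auto
      qed
      then have "((\<lambda>r. G (Complex (ln r) t)) \<longlongrightarrow> l) (at_left 1)"
        by (rule filterlim_compose[OF l])
      moreover have "\<forall>\<^sub>F r in at_left 1. G (Complex (ln r) t) = f (of_real r * cis t)"
        using eventually_at_left_real[OF zero_less_one]
      proof (rule eventually_mono)
        fix r :: real assume "r \<in> {0<..<1}"
        then have "exp (Complex (ln r) t) = of_real r * cis t"
          by (simp add: exp_eq_polar exp_of_real)
        then show "G (Complex (ln r) t) = f (of_real r * cis t)"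
          by (simp add: G_def)
      qed
      ultimately show "\<exists>l. ((\<lambda>r. f (of_real r * cis t)) \<longlongrightarrow> l) (at_left 1)"
        by (intro exI) (rule Lim_transform_eventually)
    qed
  qed
qed


section \<open>A two-valent symbol with small boundary contact\<close>

text \<open>\<open>H\<close> is a sum of ramps in \<open>1 / x\<close>: the \<open>n\<close>-th
  rises from 0 at \<open>1 / x = n + 1\<close> to 1 at \<open>1 / x = n + 2\<close>. Near each
  positive point only finitely many are nonzero, and none is for \<open>x \<ge> 1\<close>.\<close>

lemma continuous_majorant:
  fixes b :: "real \<Rightarrow> real"
  assumes b: "\<And>x y. 0 < x \<Longrightarrow> x \<le> y \<Longrightarrow> y < 1 \<Longrightarrow> b y \<le> b x"
  obtains H where "continuous_on {0<..} H" "\<And>x. 0 \<le> H x" "\<And>x. 1 \<le> x \<Longrightarrow> H x = 0"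
    "\<And>x. 0 < x \<Longrightarrow> x \<le> 1/2 \<Longrightarrow> b x \<le> H x"
proof -
  define c where "c n x = max 0 (min 1 (1 / x - real (n + 1)))" for n :: nat and x :: real
  \<comment> \<open>On the range \<open>n + 2 \<le> 1 / x < n + 3\<close> the \<open>n\<close>-th
    ramp is full, and \<open>1 / (n + 3)\<close> lies to the left of all these \<open>x\<close>;
    monotonicity makes \<open>a n\<close> dominate \<open>b\<close> there.\<close>
  define a where "a n = max 0 (b (1 / real (n + 3)))" for n :: nat
  define H where "H x = (\<Sum>n. a n * c n x)" for x
  have c0: "c n x = 0" if "1 / x \<le> real (N + 1)" "n \<notin> {..<N}" for n N x
    using that by (auto simp: c_def max_def min_def)
  have fin: "H x = (\<Sum>n<N. a n * c n x)" if "1 / x \<le> real (N + 1)" for x N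
    unfolding H_def by (rule suminf_finite) (use c0[OF that] in auto)
  have ac: "0 \<le> a n * c n x" for n x
    by (simp add: a_def c_def)
  have N: "\<exists>N. 1 / x < real (N + 1)" for x :: real
    using reals_Archimedean2[of "1 / x"] by (metis less_add_one less_trans of_nat_add of_nat_1)
  show ?thesis
  proof
    show "0 \<le> H x" for x
    proof -
      obtain N where "1 / x < real (N + 1)" using N by blast
      then have "H x = (\<Sum>n<N. a n * c n x)" by (intro fin) simp
      then show ?thesis using ac by (simp add: sum_nonneg)
    qed
    show "H x = 0" if "1 \<le> x" for x
      using fin[of x 0] that by simp
    show "continuous_on {0<..} H"
    proof (rule continuous_at_imp_continuous_on, rule ballI)
      fix x :: real assume "x \<in> {0<..}"
      then have x: "x > 0" by simp
      obtain N where N: "1 / x < real (N + 1)" using N by blast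
      have "\<forall>\<^sub>F y in nhds x. y \<in> {1 / real (N + 1)<..}"
        using N x by (intro eventually_nhds_in_open) (auto simp: field_simps)
      then have "\<forall>\<^sub>F y in nhds x. H y = (\<Sum>n<N. a n * c n y)"
      proof (rule eventually_mono)
        fix y assume "y \<in> {1 / real (N + 1)<..}"
        then have "0 < y" "1 / real (N + 1) < y"
          by (auto intro: less_trans[of 0 "1 / real (N + 1)"])
        then show "H y = (\<Sum>n<N. a n * c n y)"
          by (intro fin) (simp add: field_simps)
      qed
      moreover have "isCont (\<lambda>y. \<Sum>n<N. a n * c n y) x"
        unfolding c_def using x by (intro continuous_intros) auto
      ultimately show "isCont H x"
        using isCont_cong by fastforce
    qed
    show "b x \<le> H x" if x: "0 < x" "x \<le> 1/2" for x
    proof -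
      define n where "n = nat \<lfloor>1 / x\<rfloor> - 2"
      have "2 \<le> 1 / x" using x by (simp add: field_simps)
      then have n: "real (n + 2) \<le> 1 / x" "1 / x < real (n + 3)"
        unfolding n_def by linarith+
      then have c: "c n x = 1" by (simp add: c_def)
      have "b x \<le> a n"
      proof -
        have "1 / real (n + 3) \<le> x"
          using n(2) x by (simp add: field_simps)
        then show ?thesis
          using b[of "1 / real (n + 3)" x] x by (auto simp: a_def)
      qed
      also have "\<dots> = (\<Sum>i\<in>{n}. a i * c i x)" by (simp add: c)
      also have "\<dots> \<le> (\<Sum>i<n + 3. a i * c i x)"
        by (rule sum_mono2) (use ac in auto)
      also have "\<dots> = H x"
        using n(2) by (intro fin[symmetric]) simp
      finally show ?thesis .
    qed
  qed
qed


text \<open>Radii taken along a sequence keep limits and lower limits Borel measurable. The shift by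
  2 makes every radius positive.\<close>

definition radius_seq :: "nat \<Rightarrow> real" where
  "radius_seq k = 1 - 1 / real (k + 2)"

lemma radius_seq_bounds: "0 < radius_seq k" "radius_seq k < 1"
  by (auto simp: radius_seq_def)

lemma radius_seq_at_left: "filterlim radius_seq (at_left 1) sequentially"
  unfolding filterlim_at
proof
  have "(\<lambda>k. 1 - inverse (real (k + 2))) \<longlonglongrightarrow> 1 - 0"
    by (intro tendsto_diff tendsto_const LIMSEQ_ignore_initial_segment[OF lim_inverse_n])
  then show "radius_seq \<longlonglongrightarrow> 1"
    by (simp add: radius_seq_def[abs_def] inverse_eq_divide)
qed (use radius_seq_bounds(2) in \<open>auto simp: less_imp_neq\<close>)

text \<open>This replaces harmonic measure: \<open>L\<close> is the lower limit of the positive harmonic function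
  along radii, and Fatou's lemma controls its integral by the value at the centre.\<close>

lemma positive_harmonic_radial_minorant:
  assumes U: "U holomorphic_on unit_disk" and pos: "\<And>z. z \<in> unit_disk \<Longrightarrow> 0 \<le> Re (U z)"
  obtains L :: "real \<Rightarrow> ennreal" where "L \<in> borel_measurable borel"
    "(\<integral>\<^sup>+ t. L t \<partial>lborel) \<le> ennreal (2 * pi * Re (U 0))"
    "\<And>t M. t \<in> {0..2*pi} \<Longrightarrow>
       \<forall>\<^sub>F k in sequentially. M \<le> Re (U (of_real (radius_seq k) * cis t)) \<Longrightarrow> ennreal M \<le> L t"
proof -
  define u where "u k t = ennreal (Re (U (of_real (radius_seq k) * cis t))) * indicator {0..2*pi} t" for k t
  have in_disk: "of_real (radius_seq k) * cis t \<in> unit_disk" for k t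
    using radius_seq_bounds[of k] by (simp add: norm_mult)
  have meas [measurable]: "u k \<in> borel_measurable borel" for k
  proof -
    have "continuous_on UNIV (\<lambda>t. U (of_real (radius_seq k) * cis t))"
      by (rule continuous_on_compose2[OF holomorphic_on_imp_continuous_on[OF U]])
         (use in_disk in \<open>auto intro!: continuous_intros\<close>)
    then have "continuous_on UNIV (\<lambda>t. Re (U (of_real (radius_seq k) * cis t)))"
      by (intro continuous_intros)
    then have [measurable]: "(\<lambda>t. Re (U (of_real (radius_seq k) * cis t))) \<in> borel_measurable borel"
      by (rule borel_measurable_continuous_onI)
    show ?thesis unfolding u_def by measurable
  qed
  have int: "(\<integral>\<^sup>+ t. u k t \<partial>lborel) = ennreal (2 * pi * Re (U 0))" for k
  proof -
    have "((\<lambda>t. Re (U (of_real (radius_seq k) * cis t))) has_integral Re (2 * pi * U 0)) {0..2*pi}"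
      by (intro has_integral_Re holomorphic_mean_value U radius_seq_bounds)
    then show ?thesis
      unfolding u_def using pos[OF in_disk] by (subst nn_integral_has_integral_lebesgue') auto
  qed
  show ?thesis
  proof
    show "(\<lambda>t. liminf (\<lambda>k. u k t)) \<in> borel_measurable borel" by measurable
    have "(\<integral>\<^sup>+ t. liminf (\<lambda>k. u k t) \<partial>lborel) \<le> liminf (\<lambda>k. \<integral>\<^sup>+ t. u k t \<partial>lborel)"
      by (rule nn_integral_liminf) simp
    then show "(\<integral>\<^sup>+ t. liminf (\<lambda>k. u k t) \<partial>lborel) \<le> ennreal (2 * pi * Re (U 0))"
      by (simp add: int Liminf_const)
    fix t M assume t: "t \<in> {0..2*pi}"
      and ev: "\<forall>\<^sub>F k in sequentially. M \<le> Re (U (of_real (radius_seq k) * cis t))"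
    show "ennreal M \<le> liminf (\<lambda>k. u k t)"
      by (rule Liminf_bounded, rule eventually_mono[OF ev]) (use t in \<open>auto simp: u_def intro!: ennreal_leI\<close>)
  qed
qed

text \<open>The linear term of the barrier controls \<open>Re z\<close>, and the exponential term
  controls \<open>Im z\<close> above \<open>4 * pi\<close>. Hence the barrier tends to infinity
  whenever \<open>z\<close> does.\<close>

lemma strip_domain_norm_le:
  assumes z: "z \<in> strip_domain H" and H: "\<And>x. 1 \<le> x \<Longrightarrow> H x = 0" "\<And>x. 0 \<le> H x"
  shows "cmod z \<le> 4 * pi + 3 * Re (strip_barrier z)"
proof -
  have x: "Re z > 0" "Im z > 0"
    using z H(2)[of "Re z"] by (auto simp: strip_domain_def)
  have 1: "Re (strip_barrier z) \<ge> 1 + Re z"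
    by (rule strip_barrier_ge(1)[OF z H(1)])
  have "Im z \<le> 4 * pi + 2 * Re (strip_barrier z)"
  proof (cases "4 * pi \<le> Im z")
    case True
    then have "Re (strip_barrier z) \<ge> 1 + Re z + exp (Im z) / 2"
      using strip_barrier_ge(2)[OF z H(1)] by simp
    moreover have "1 + Im z \<le> exp (Im z)" by (rule exp_ge_add_one_self)
    ultimately show ?thesis using x pi_gt_zero by linarith
  qed (use 1 x in linarith)
  moreover have "cmod z \<le> \<bar>Re z\<bar> + \<bar>Im z\<bar>" by (rule cmod_le)
  ultimately show ?thesis using 1 x by linarith
qed

text \<open>Write \<open>g = 1 / f - 1\<close> with \<open>f\<close> univalent and bounded by 1.
  Radial limits of \<open>f\<close> pass to \<open>g\<close> unless they are 0, and a zero limit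
  would make the minorant \<open>L\<close> infinite, which happens only on a null set.\<close>

lemma exp_strip_radial_limit:
  assumes g: "g holomorphic_on unit_disk" "inj_on g unit_disk" "g ` unit_disk = strip_domain H"
    and H: "\<And>x. 1 \<le> x \<Longrightarrow> H x = 0" "\<And>x. 0 \<le> H x"
  shows "AE t in lborel. t \<in> {0<..<2*pi} \<longrightarrow>
           (\<exists>l. ((\<lambda>r. exp (- g (of_real r * cis t))) \<longlongrightarrow> l) (at_left 1))"
proof -
  define U where "U z = strip_barrier (g z)" for z
  have gz: "g z \<in> strip_domain H" if "z \<in> unit_disk" for z
    using that g(3) by blast
  have U: "U holomorphic_on unit_disk"
    unfolding U_def by (intro holomorphic_intros g)
  have pos: "0 \<le> Re (U z)" if "z \<in> unit_disk" for z
    using strip_barrier_ge(1)[OF gz[OF that] H(1)] gz[OF that] by (auto simp: U_def strip_domain_def)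
  obtain L :: "real \<Rightarrow> ennreal" where L: "L \<in> borel_measurable borel"
    "(\<integral>\<^sup>+ t. L t \<partial>lborel) \<le> ennreal (2 * pi * Re (U 0))"
    "\<And>t M. t \<in> {0..2*pi} \<Longrightarrow>
       \<forall>\<^sub>F k in sequentially. M \<le> Re (U (of_real (radius_seq k) * cis t)) \<Longrightarrow> ennreal M \<le> L t"
    using positive_harmonic_radial_minorant[OF U pos] by blast
  have Lfin: "AE t in lborel. L t \<noteq> \<infinity>"
    using L(1,2) by (intro nn_integral_PInf_AE) (auto simp: top_unique)
  define f where "f z = inverse (g z + 1)" for z
  have g1: "1 \<le> cmod (g z + 1)" if "z \<in> unit_disk" for z
    using gz[OF that] complex_Re_le_cmod[of "g z + 1"] by (auto simp: strip_domain_def)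
  have g0: "g z + 1 \<noteq> 0" if "z \<in> unit_disk" for z
    using g1[OF that] by auto
  have "f holomorphic_on unit_disk"
    unfolding f_def by (intro holomorphic_intros g g0)
  moreover have "inj_on f unit_disk"
    using g(2) by (auto simp: f_def inj_on_def)
  moreover have "bounded (f ` unit_disk)"
    unfolding bounded_iff
  proof (intro exI ballI)
    fix w assume "w \<in> f ` unit_disk"
    then obtain z where "z \<in> unit_disk" "w = f z" by blast
    then show "norm w \<le> 1"
      using g1[of z] by (auto simp: f_def norm_inverse inverse_le_1_iff)
  qed
  ultimately have "AE t in lborel. t \<in> {0<..<2*pi} \<longrightarrow> (\<exists>l. ((\<lambda>r. f (of_real r * cis t)) \<longlongrightarrow> l) (at_left 1))"
    by (rule bounded_univalent_radial_limit)
  then show ?thesis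
    using Lfin
  proof eventually_elim
    case (elim t)
    show ?case
    proof
      assume t: "t \<in> {0<..<2*pi}"
      then obtain l where l: "((\<lambda>r. f (of_real r * cis t)) \<longlongrightarrow> l) (at_left 1)"
        using elim(1) by blast
      have in_disk: "of_real (radius_seq k) * cis t \<in> unit_disk" for k
        using radius_seq_bounds[of k] by (simp add: norm_mult)
      \<comment> \<open>\<open>l = 0\<close> would mean that \<open>g\<close> is unbounded along the radius, and then so is the barrier.\<close>
      have "l \<noteq> 0"
      proof
        assume "l = 0"
        have lim: "(\<lambda>k. f (of_real (radius_seq k) * cis t)) \<longlonglongrightarrow> 0"
          using filterlim_compose[OF l radius_seq_at_left] \<open>l = 0\<close> by simp
        have "ennreal M \<le> L t" if M: "0 < M" for M
        proof (rule L(3))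
          show "t \<in> {0..2*pi}" using t by simp
          \<comment> \<open>A value of \<open>f\<close> below \<open>\<epsilon>\<close> forces
            \<open>cmod g > 4 * pi + 3 * M\<close>, the size at which
            \<open>strip_domain_norm_le\<close> makes the barrier exceed \<open>M\<close>.\<close>
          define \<epsilon> where "\<epsilon> = inverse (4 * pi + 3 * M + 1)"
          have \<epsilon>: "0 < \<epsilon>"
            using M pi_gt_zero unfolding \<epsilon>_def by (intro positive_imp_inverse_positive) linarith
          have "\<forall>\<^sub>F k in sequentially. cmod (f (of_real (radius_seq k) * cis t)) < \<epsilon>"
            using tendstoD[OF lim \<epsilon>] by simp
          then show "\<forall>\<^sub>F k in sequentially. M \<le> Re (U (of_real (radius_seq k) * cis t))"
          proof (rule eventually_mono)
            fix k
            let ?z = "of_real (radius_seq k) * cis t"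
            assume "cmod (f ?z) < \<epsilon>"
            then have "inverse (cmod (g ?z + 1)) < inverse (4 * pi + 3 * M + 1)"
              by (simp add: f_def \<epsilon>_def norm_inverse)
            moreover have "0 < cmod (g ?z + 1)"
              using g1[OF in_disk] less_le_trans zero_less_one by blast
            ultimately have "4 * pi + 3 * M + 1 < cmod (g ?z + 1)"
              by (rule inverse_less_imp_less)
            also have "\<dots> \<le> cmod (g ?z) + 1"
              using norm_triangle_ineq[of "g ?z" 1] by simp
            also have "\<dots> \<le> 4 * pi + 3 * Re (U ?z) + 1"
              using strip_domain_norm_le[OF gz[OF in_disk] H] by (simp add: U_def)
            finally show "M \<le> Re (U ?z)" by simp
          qed
        qed
        then have "L t = \<infinity>"
        proof (cases "L t")
          case (real a)
          then have "ennreal (a + 1) \<le> ennreal a"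
            using \<open>\<And>M. 0 < M \<Longrightarrow> ennreal M \<le> L t\<close>[of "a + 1"] by simp
          then show ?thesis using real(1) by simp
        qed simp
        then show False using elim(2) by simp
      qed
      have "((\<lambda>r. exp (- (inverse (f (of_real r * cis t)) - 1))) \<longlongrightarrow> exp (- (inverse l - 1))) (at_left 1)"
        by (intro tendsto_intros l \<open>l \<noteq> 0\<close>)
      then have "((\<lambda>r. exp (- g (of_real r * cis t))) \<longlongrightarrow> exp (- (inverse l - 1))) (at_left 1)"
        by (simp add: f_def)
      then show "\<exists>l. ((\<lambda>r. exp (- g (of_real r * cis t))) \<longlongrightarrow> l) (at_left 1)"
        by blast
    qed
  qed
qed

lemma exists_two_valent_symbol:
  fixes \<delta> :: "real \<Rightarrow> real"
  assumes \<delta>: "\<And>h. h \<in> {0<..<1} \<Longrightarrow> \<delta> h \<in> {0<..<1}" and mono: "mono_on {0<..<1} \<delta>"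
  shows "\<exists>\<phi> h0. \<phi> holomorphic_on unit_disk \<and> p_valent 2 \<phi> \<and>
           \<phi> ` unit_disk = unit_disk - {0} \<and> 0 < h0 \<and> h0 < 1 \<and>
           (\<forall>h. 0 < h \<and> h \<le> h0 \<longrightarrow>
              circle_measurable {z \<in> sphere 0 1. cmod (radial_limit \<phi> z) \<ge> 1 - h} \<and>
              circle_measure {z \<in> sphere 0 1. cmod (radial_limit \<phi> z) \<ge> 1 - h} \<le> \<delta> h)"
proof -
  \<comment> \<open>Points with \<open>\<bar>\<phi>\<bar> > 1 - 2 * h\<close> will have
    \<open>x < 4 * h\<close>, hence \<open>H x \<ge> b (4 * h) = 1 / (4 * h * \<delta> h)\<close>.
    The factor \<open>1 / x\<close> absorbs the constant: Markov's inequality yields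
    \<open>8 * C * h * \<delta> h\<close>, at most \<open>\<delta> h\<close> for small
    \<open>h\<close>.\<close>
  define b where "b x = 1 / (x * \<delta> (x / 4))" for x
  have \<delta>0: "0 < \<delta> h" if "0 < h" "h < 1" for h
    using \<delta>[of h] that by simp
  have b: "b y \<le> b x" if "0 < x" "x \<le> y" "y < 1" for x y
  proof -
    have "\<delta> (x / 4) \<le> \<delta> (y / 4)"
      by (rule mono_onD[OF mono]) (use that in auto)
    moreover have "0 < \<delta> (x / 4)" "0 < \<delta> (y / 4)"
      by (rule \<delta>0; use that in simp)+
    ultimately show ?thesis
      unfolding b_def using that by (intro divide_left_mono mult_mono mult_pos_pos) auto
  qed
  obtain H where H: "continuous_on {0<..} H" "\<And>x. 0 \<le> H x" "\<And>x. 1 \<le> x \<Longrightarrow> H x = 0"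
      "\<And>x. 0 < x \<Longrightarrow> x \<le> 1/2 \<Longrightarrow> b x \<le> H x"
    using continuous_majorant[of b] b by blast
  obtain g where g: "g holomorphic_on unit_disk" "inj_on g unit_disk" "g ` unit_disk = strip_domain H"
    using strip_domain_Riemann_map[OF H(1)] by blast
  define \<phi> where "\<phi> z = exp (- g z)" for z
  define U where "U z = strip_barrier (g z)" for z
  define C where "C = Re (U 0)"
  have gz: "g z \<in> strip_domain H" if "z \<in> unit_disk" for z
    using that g(3) by blast
  have U: "U holomorphic_on unit_disk"
    unfolding U_def by (intro holomorphic_intros g)
  have U1: "1 \<le> Re (U z)" if "z \<in> unit_disk" for z
    using strip_barrier_ge(1)[OF gz[OF that] H(3)] gz[OF that] by (auto simp: U_def strip_domain_def)
  have U0: "0 \<le> Re (U z)" if "z \<in> unit_disk" for z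
    using U1[OF that] by simp
  have C: "1 \<le> C" unfolding C_def by (rule U1) simp
  obtain L :: "real \<Rightarrow> ennreal" where L [measurable]: "L \<in> borel_measurable borel"
    and Lint: "(\<integral>\<^sup>+ t. L t \<partial>lborel) \<le> ennreal (2 * pi * C)"
    and Lge: "\<And>t M. t \<in> {0..2*pi} \<Longrightarrow>
       \<forall>\<^sub>F k in sequentially. M \<le> Re (U (of_real (radius_seq k) * cis t)) \<Longrightarrow> ennreal M \<le> L t"
    using positive_harmonic_radial_minorant[OF U U0] unfolding C_def by blast
  have in_disk: "of_real (radius_seq k) * cis t \<in> unit_disk" for k t
    using radius_seq_bounds[of k] by (simp add: norm_mult)
  have hol: "\<phi> holomorphic_on unit_disk"
    unfolding \<phi>_def by (intro holomorphic_intros g)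
  \<comment> \<open>\<open>radial_limit\<close> is unspecified where no limit exists. Measurability
    is obtained for the Borel function \<open>\<rho>\<close> and transferred by agreement almost
    everywhere.\<close>
  define \<rho> where "\<rho> t = lim (\<lambda>k. \<phi> (of_real (radius_seq k) * cis t))" for t
  have [measurable]: "\<rho> \<in> borel_measurable borel"
  proof -
    have "continuous_on UNIV (\<lambda>t. \<phi> (of_real (radius_seq k) * cis t))" for k
      by (rule continuous_on_compose2[OF holomorphic_on_imp_continuous_on[OF hol]])
         (use in_disk in \<open>auto intro!: continuous_intros\<close>)
    then have [measurable]: "(\<lambda>t. \<phi> (of_real (radius_seq k) * cis t)) \<in> borel_measurable borel" for k
      by (rule borel_measurable_continuous_onI)
    show ?thesis unfolding \<rho>_def by measurable
  qed
  have AE_exp: "AE t in lborel. t \<in> {0<..<2*pi} \<longrightarrow>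
      (\<exists>l. ((\<lambda>r. exp (- g (of_real r * cis t))) \<longlongrightarrow> l) (at_left 1))"
    by (rule exp_strip_radial_limit[OF g]) (use H in auto)
  have AE_lim: "AE t in lborel. t \<in> {0..<2*pi} \<longrightarrow>
      (\<lambda>k. \<phi> (of_real (radius_seq k) * cis t)) \<longlonglongrightarrow> radial_limit \<phi> (cis t) \<and>
      radial_limit \<phi> (cis t) = \<rho> t"
    \<comment> \<open>The angle 0, outside the open interval of \<open>AE_exp\<close>, is discarded
      as a null set.\<close>
    using AE_exp AE_lborel_singleton[of 0]
  proof eventually_elim
    case (elim t)
    show ?case
    proof
      assume "t \<in> {0..<2*pi}"
      then have "t \<in> {0<..<2*pi}" using elim(2) by auto
      then obtain l where l: "((\<lambda>r. \<phi> (of_real r * cis t)) \<longlongrightarrow> l) (at_left 1)"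
        using elim(1) unfolding \<phi>_def by blast
      then have "radial_limit \<phi> (cis t) = l"
        unfolding radial_limit_def by (intro tendsto_Lim) auto
      moreover have k: "(\<lambda>k. \<phi> (of_real (radius_seq k) * cis t)) \<longlonglongrightarrow> l"
        by (rule filterlim_compose[OF l radius_seq_at_left])
      moreover have "\<rho> t = l"
        unfolding \<rho>_def by (rule limI[OF k])
      ultimately show "(\<lambda>k. \<phi> (of_real (radius_seq k) * cis t)) \<longlonglongrightarrow> radial_limit \<phi> (cis t) \<and>
          radial_limit \<phi> (cis t) = \<rho> t"
        by simp
    qed
  qed
  \<comment> \<open>The threshold makes \<open>8 * C * h \<le> 1\<close> at the end. Since
    \<open>C \<ge> 1\<close> it also gives \<open>4 * h \<le> 1/2\<close>, the range where
    \<open>H\<close> dominates \<open>b\<close>.\<close>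
  have small: "circle_measurable {z \<in> sphere 0 1. cmod (radial_limit \<phi> z) \<ge> 1 - h} \<and>
      circle_measure {z \<in> sphere 0 1. cmod (radial_limit \<phi> z) \<ge> 1 - h} \<le> \<delta> h"
    if h: "0 < h" "h \<le> 1 / (8 * C)" for h
  proof -
    have "1 / (8 * C) \<le> 1/8" using C by (simp add: field_simps)
    then have h8: "h \<le> 1/8" using h by linarith
    have \<delta>h: "0 < \<delta> h" by (rule \<delta>0) (use h h8 in auto)
    define M where "M = 1 / (8 * h * \<delta> h)"
    have M: "0 < M" using h \<delta>h by (simp add: M_def)
    define A where "A = {t \<in> {0..<2*pi}. cmod (radial_limit \<phi> (cis t)) \<ge> 1 - h}"
    define A' where "A' = {t \<in> {0..<2*pi}. cmod (\<rho> t) \<ge> 1 - h}"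
    have A_eq: "{t \<in> {0..<2*pi}. cis t \<in> {z \<in> sphere 0 1. cmod (radial_limit \<phi> z) \<ge> 1 - h}} = A"
      by (auto simp: A_def)
    have A': "A' \<in> sets borel"
      unfolding A'_def by measurable
    have AE_eq: "AE t in lebesgue. t \<in> A' \<longleftrightarrow> t \<in> A"
      using AE_completion[OF AE_lim] by eventually_elim (auto simp: A_def A'_def)
    \<comment> \<open>Completeness of Lebesgue measure: \<open>A\<close> agrees with a Borel set up
      to a null set.\<close>
    have A: "A \<in> sets lebesgue"
      by (rule completion.in_sets_AE[OF AE_eq]) (use A' in auto)
    have "AE t in lebesgue. t \<in> A \<longrightarrow> ennreal M \<le> L t"
      using AE_completion[OF AE_lim]
    proof eventually_elim
      case (elim t)
      show ?case
      proof
        assume "t \<in> A"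
        then have t: "t \<in> {0..<2*pi}" "1 - h \<le> cmod (radial_limit \<phi> (cis t))" by (auto simp: A_def)
        then have "(\<lambda>k. \<phi> (of_real (radius_seq k) * cis t)) \<longlonglongrightarrow> radial_limit \<phi> (cis t)"
          using elim by blast
        then have "(\<lambda>k. cmod (\<phi> (of_real (radius_seq k) * cis t))) \<longlonglongrightarrow> cmod (radial_limit \<phi> (cis t))"
          by (rule tendsto_norm)
        \<comment> \<open>Doubling \<open>h\<close> provides the strict inequality that passes from
          the limit to the radii near 1.\<close>
        moreover have "1 - 2 * h < cmod (radial_limit \<phi> (cis t))" using t h by linarith
        ultimately have "\<forall>\<^sub>F k in sequentially. 1 - 2 * h < cmod (\<phi> (of_real (radius_seq k) * cis t))"
          by (rule order_tendstoD(1))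
        then have "\<forall>\<^sub>F k in sequentially. M \<le> Re (U (of_real (radius_seq k) * cis t))"
        proof (rule eventually_mono)
          fix k
          let ?z = "of_real (radius_seq k) * cis t"
          define x where "x = Re (g ?z)"
          assume "1 - 2 * h < cmod (\<phi> ?z)"
          then have lt: "1 - 2 * h < exp (- x)" by (simp add: \<phi>_def x_def)
          have x: "0 < x" "H x < Im (g ?z)"
            using gz[OF in_disk] by (auto simp: x_def strip_domain_def)
          have "1 + x \<le> exp x" by (rule exp_ge_add_one_self)
          then have "exp (- x) \<le> 1 / (1 + x)"
            using x by (simp add: exp_minus field_simps)
          then have "1 - 2 * h < 1 / (1 + x)" using lt by linarith
          then have "(1 - 2 * h) * (1 + x) < 1"
            using x by (simp add: field_simps)
          then have "x * (1 - 2 * h) < 2 * h" by (simp add: algebra_simps)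
          moreover have "x * (1/2) \<le> x * (1 - 2 * h)"
            using x h8 by (intro mult_left_mono) auto
          ultimately have x4: "x < 4 * h" by linarith
          have "b (4 * h) \<le> b x"
            by (rule b) (use x x4 h8 in auto)
          also have "b x \<le> H x"
            by (rule H(4)) (use x x4 h8 in auto)
          also have "\<dots> \<le> exp (Im (g ?z))"
            using x exp_ge_add_one_self[of "Im (g ?z)"] by linarith
          finally have "b (4 * h) / 2 \<le> exp (Im (g ?z)) / 2" by simp
          also have "\<dots> \<le> Re (U ?z)"
            using strip_barrier_ge(2)[OF gz[OF in_disk] H(3), of k t] x x4 h8 by (simp add: U_def x_def)
          finally show "M \<le> Re (U ?z)"
            by (simp add: M_def b_def)
        qed
        then show "ennreal M \<le> L t"
          by (rule Lge[rotated]) (use t in auto)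
      qed
    qed
    \<comment> \<open>Markov's inequality for \<open>L\<close> at level \<open>M\<close>.\<close>
    then have "(\<integral>\<^sup>+ t. ennreal M * indicator A t \<partial>lebesgue) \<le> (\<integral>\<^sup>+ t. L t \<partial>lebesgue)"
      by (intro nn_integral_mono_AE) (auto simp: indicator_def)
    also have "\<dots> = (\<integral>\<^sup>+ t. L t \<partial>lborel)"
      by (simp add: nn_integral_completion)
    finally have "ennreal M * emeasure lebesgue A \<le> ennreal (2 * pi * C)"
      using Lint A by (simp add: nn_integral_cmult_indicator)
    moreover have fin: "emeasure lebesgue A \<noteq> \<infinity>"
    proof -
      have "emeasure lebesgue A \<le> emeasure lebesgue {0..2*pi}"
        by (rule emeasure_mono) (auto simp: A_def)
      then show ?thesis by (auto simp: top_unique)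
    qed
    ultimately have "ennreal (M * measure lebesgue A) \<le> ennreal (2 * pi * C)"
      using M by (simp add: emeasure_eq_ennreal_measure ennreal_mult)
    then have "M * measure lebesgue A \<le> 2 * pi * C"
      using C by (subst (asm) ennreal_le_iff) auto
    then have "measure lebesgue A / (2 * pi) \<le> 8 * C * h * \<delta> h"
      using h \<delta>h by (simp add: M_def field_simps)
    also have "\<dots> \<le> 1 * \<delta> h"
      using h \<delta>h C by (intro mult_right_mono) (auto simp: field_simps)
    finally show ?thesis
      unfolding circle_measurable_def circle_measure_def A_eq using A by simp
  qed
  show ?thesis
  proof (intro exI conjI)
    show "p_valent 2 \<phi>" "\<phi> ` unit_disk = unit_disk - {0}"
      using p_valent_exp_strip[OF g(2,3)] image_exp_strip[OF g(3)] unfolding \<phi>_def by auto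
    show "0 < 1 / (8 * C)" "1 / (8 * C) < 1" using C by (auto simp: field_simps)
  qed (use hol small in auto)
qed


section \<open>A surjective symbol in all Schatten classes\<close>

text \<open>The automorphism \<open>(w - a) / (1 - a * w)\<close> with \<open>a = 1/2\<close>,
  cleared of fractions. Its square takes the value \<open>1/4\<close> at 0 and again at
  \<open>4/5\<close>, so removing 0 loses no value.\<close>

definition half_moebius :: "complex \<Rightarrow> complex" where
  "half_moebius w = (2 * w - 1) / (2 - w)"

lemma half_moebius_denominator: "cmod w < 1 \<Longrightarrow> 2 - w \<noteq> 0"
  by auto

lemma half_moebius_norm:
  assumes "cmod w < 1"
  shows "1 - (cmod (half_moebius w))\<^sup>2 = 3 * (1 - (cmod w)\<^sup>2) / (cmod (2 - w))\<^sup>2"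
proof -
  have "(cmod (2 - w))\<^sup>2 \<noteq> 0"
    using half_moebius_denominator[OF assms] by simp
  moreover have "(cmod (2 - w))\<^sup>2 - (cmod (2 * w - 1))\<^sup>2 = 3 * (1 - (cmod w)\<^sup>2)"
    unfolding cmod_power2 by (simp add: power2_eq_square algebra_simps)
  ultimately show ?thesis
    by (simp add: half_moebius_def norm_divide power_divide field_simps)
qed

text \<open>Since \<open>cmod (2 - w) \<le> 3\<close>, the exact identity loses at most a factor 3;
  bounds on how close \<open>\<phi>\<close> comes to the circle thus carry over.\<close>

lemma half_moebius_norm_ge:
  assumes "cmod w < 1"
  shows "(1 - (cmod w)\<^sup>2) / 3 \<le> 1 - (cmod (half_moebius w))\<^sup>2"
proof -
  have "cmod (2 - w) \<le> 3"
    using norm_triangle_ineq4[of 2 w] assms by simp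
  moreover have "cmod (2 - w) > 0"
    using half_moebius_denominator[OF assms] by (metis zero_less_norm_iff)
  ultimately  have "(cmod (2 - w))\<^sup>2 \<le> 3\<^sup>2" "(cmod (2 - w))\<^sup>2 > 0"
    by (auto simp only: norm_ge_zero intro!: power_mono zero_less_power)
  moreover have "0 \<le> 1 - (cmod w)\<^sup>2"
    using assms by (simp add: power_le_one)
  ultimately have "3 * (1 - (cmod w)\<^sup>2) / 9 \<le> 3 * (1 - (cmod w)\<^sup>2) / (cmod (2 - w))\<^sup>2"
    by (intro divide_left_mono) auto
  then show ?thesis
    unfolding half_moebius_norm[OF assms] by linarith
qed

lemma half_moebius_in_disk:
  assumes "cmod w < 1"
  shows "cmod (half_moebius w) < 1"
proof -
  have "0 < (1 - (cmod w)\<^sup>2) / 3"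
    using assms by (simp add: power_less_one_iff)
  then have "(cmod (half_moebius w))\<^sup>2 < 1"
    using half_moebius_norm_ge[OF assms] by linarith
  then show ?thesis by (simp add: power_less_one_iff)
qed

text \<open>Solving \<open>v = (2 * w - 1) / (2 - w)\<close> gives
  \<open>w = (2 * v + 1) / (2 + v)\<close>, the same map conjugated by negation.\<close>

lemma half_moebius_inverse:
  assumes "cmod w < 1"
  shows "- half_moebius (- half_moebius w) = w"
proof -
  have "2 + half_moebius w = 3 / (2 - w)"
    using half_moebius_denominator[OF assms] by (simp add: half_moebius_def field_simps)
  moreover have "- 2 * half_moebius w - 1 = - 3 * w / (2 - w)"
    using half_moebius_denominator[OF assms] by (simp add: half_moebius_def field_simps)
  moreover have "- half_moebius (- half_moebius w) = - ((- 2 * half_moebius w - 1) / (2 + half_moebius w))"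
    by (simp add: half_moebius_def[of "- half_moebius w"])
  ultimately show ?thesis
    using half_moebius_denominator[OF assms] by simp
qed

lemma half_moebius_square_valence:
  "finite {v \<in> unit_disk. (half_moebius v)\<^sup>2 = w}" "card {v \<in> unit_disk. (half_moebius v)\<^sup>2 = w} \<le> 2"
proof -
  let ?A = "{v \<in> unit_disk. (half_moebius v)\<^sup>2 = w}"
  have "inj_on half_moebius ?A"
  proof (rule inj_onI)
    fix u v assume "u \<in> ?A" "v \<in> ?A" "half_moebius u = half_moebius v"
    then show "u = v"
      by (metis (no_types, lifting) half_moebius_inverse mem_Collect_eq mem_ball_0)
  qed
  moreover have sub: "half_moebius ` ?A \<subseteq> {csqrt w, - csqrt w}"
  proof
    fix u assume "u \<in> half_moebius ` ?A"
    then have "u\<^sup>2 = (csqrt w)\<^sup>2" by auto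
    then show "u \<in> {csqrt w, - csqrt w}"
      unfolding power2_eq_iff by blast
  qed
  ultimately show "finite ?A"
    by (meson finite.emptyI finite.insertI finite_imageD finite_subset)
  have "card ?A = card (half_moebius ` ?A)"
    using \<open>inj_on half_moebius ?A\<close> by (simp add: card_image)
  also have "\<dots> \<le> card {csqrt w, - csqrt w}"
    by (rule card_mono[OF _ sub]) simp
  also have "\<dots> \<le> 2"
    by (simp add: card_insert_if)
  finally show "card ?A \<le> 2" .
qed

lemma half_moebius_square_image: "(\<lambda>v. (half_moebius v)\<^sup>2) ` (unit_disk - {0}) = unit_disk"
proof
  show "(\<lambda>v. (half_moebius v)\<^sup>2) ` (unit_disk - {0}) \<subseteq> unit_disk"
    using half_moebius_in_disk by (auto simp: norm_power power_less_one_iff)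
  show "unit_disk \<subseteq> (\<lambda>v. (half_moebius v)\<^sup>2) ` (unit_disk - {0})"
  proof
    fix w :: complex assume "w \<in> unit_disk"
    \<comment> \<open>\<open>half_moebius 0 = - 1/2\<close>, so a square root other than
      \<open>- 1/2\<close> has a nonzero preimage. If \<open>csqrt w\<close> were
      \<open>- 1/2\<close>, the opposite root would serve.\<close>
    define u where "u = (if csqrt w = - 1/2 then 1/2 else csqrt w)"
    have "(csqrt w)\<^sup>2 = w" by simp
    then have u: "u\<^sup>2 = w" "u \<noteq> - 1/2"
      by (auto simp: u_def power2_eq_square)
    have "(cmod u)\<^sup>2 < 1"
      using u(1) \<open>w \<in> unit_disk\<close> by (auto simp flip: norm_power)
    then have u1: "cmod (- u) < 1" by (simp add: power_less_one_iff)
    have "half_moebius (- half_moebius (- u)) = u"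
      using half_moebius_inverse[OF u1] by (metis neg_equal_iff_equal)
    moreover have "half_moebius (- u) \<noteq> 0"
    proof
      assume "half_moebius (- u) = 0"
      then have "2 * (- u) - 1 = 0"
        using half_moebius_denominator[OF u1] unfolding half_moebius_def by (metis divide_eq_0_iff)
      then have "u = (- 1) / 2"
        by (metis diff_eq_eq add_0 mult_minus_right minus_minus nonzero_mult_div_cancel_left zero_neq_numeral)
      then show False using u(2) by contradiction
    qed
    ultimately show "w \<in> (\<lambda>v. (half_moebius v)\<^sup>2) ` (unit_disk - {0})"
      using half_moebius_in_disk[OF u1] u(1)
      by (intro image_eqI[of _ _ "- half_moebius (- u)"]) auto
  qed
qed

lemma p_valent_compose:
  assumes f: "p_valent p f" "f ` unit_disk \<subseteq> unit_disk"
    and B: "\<And>w. finite {v \<in> unit_disk. B v = w}" "\<And>w. card {v \<in> unit_disk. B v = w} \<le> q"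
  shows "p_valent (q * p) (\<lambda>z. B (f z))"
  unfolding p_valent_def
proof (intro allI conjI)
  fix w
  let ?V = "{v \<in> unit_disk. B v = w}"
  have eq: "{z \<in> unit_disk. B (f z) = w} = (\<Union>v\<in>?V. {z \<in> unit_disk. f z = v})"
    using f(2) by blast
  have F: "finite {z \<in> unit_disk. f z = v}" "card {z \<in> unit_disk. f z = v} \<le> p" for v
    using f(1) unfolding p_valent_def by blast+
  show "finite {z \<in> unit_disk. B (f z) = w}"
    unfolding eq using B(1) F(1) by blast
  have "card {z \<in> unit_disk. B (f z) = w} \<le> (\<Sum>v\<in>?V. card {z \<in> unit_disk. f z = v})"
    unfolding eq by (rule card_UN_le[OF B(1)])
  also have "\<dots> \<le> (\<Sum>v\<in>?V. p)"
    by (intro sum_mono F)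
  also have "\<dots> \<le> q * p"
    using B(2) by simp
  finally show "card {z \<in> unit_disk. B (f z) = w} \<le> q * p" .
qed

section \<open>Decay of the truncation error\<close>

lemma power_div_fact_le_exp:
  fixes t :: real
  assumes "0 \<le> t"
  shows "t ^ k / fact k \<le> exp t"
proof -
  have "(\<Sum>n\<in>{k}. inverse (fact n) * t ^ n) \<le> (\<Sum>n. inverse (fact n) * t ^ n)"
    by (rule sum_le_suminf[OF summable_exp]) (use assms in auto)
  then show ?thesis
    by (simp add: exp_def scaleR_conv_of_real field_simps)
qed

text \<open>With \<open>s = (n + 1) * y\<close>, one term of the exponential series gives
  \<open>exp (- s) \<le> fact N / s ^ N\<close>. Replacing \<open>n\<close> by \<open>n + 1\<close>
  costs only \<open>exp y \<le> exp 1\<close> and keeps the denominator positive at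
  \<open>n = 0\<close>.\<close>

lemma exp_decay_bound:
  assumes y: "0 < y" "y \<le> 1"
  shows "exp (- (real n * y)) / y \<le> exp 1 * fact N / real (Suc n) ^ N * (1 / y) ^ Suc N"
proof -
  have "(real (Suc n) * y) ^ N / fact N \<le> exp (real (Suc n) * y)"
    by (rule power_div_fact_le_exp) (use y in simp)
  then have "exp (- (real (Suc n) * y)) \<le> fact N / (real (Suc n) * y) ^ N"
    using y by (simp add: exp_minus divide_simps mult_ac)
  moreover have "exp (- (real n * y)) = exp y * exp (- (real (Suc n) * y))"
    by (simp add: algebra_simps flip: exp_add)
  moreover have "exp y \<le> exp 1" using y by simp
  ultimately have "exp (- (real n * y)) \<le> exp 1 * (fact N / (real (Suc n) * y) ^ N)"
    by (simp only:) (intro mult_mono; simp)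
  then have "exp (- (real n * y)) / y \<le> exp 1 * (fact N / (real (Suc n) * y) ^ N) / y"
    using y by (intro divide_right_mono) auto
  then show ?thesis
    by (simp add: power_mult_distrib power_divide divide_simps mult_ac)
qed

lemma exists_surjective_schatten_symbol:
  "\<exists>\<psi>. \<psi> holomorphic_on unit_disk \<and> \<psi> ` unit_disk = unit_disk \<and> p_valent 4 \<psi> \<and>
     (\<forall>p>0. schatten_class p (composition_op \<psi>))"
proof -
  \<comment> \<open>Up to the factor \<open>exp 1\<close>, \<open>exp (H x)\<close> is at least
    \<open>exp (1 / x)\<close>, which dominates every power of \<open>1 / x\<close>; hence one
    symbol serves for all \<open>p\<close>.\<close>
  define H where "H x = max 0 (1 / x - 1)" for x :: real
  have H0: "H x = 0" if "1 \<le> x" for x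
    using that by (simp add: H_def)
  have "continuous_on {0<..} H"
    unfolding H_def by (intro continuous_intros) auto
  then obtain g where g: "g holomorphic_on unit_disk" "inj_on g unit_disk" "g ` unit_disk = strip_domain H"
    by (rule strip_domain_Riemann_map)
  define \<phi> where "\<phi> z = exp (- g z)" for z
  define \<psi> where "\<psi> z = (half_moebius (\<phi> z))\<^sup>2" for z
  have \<phi>: "\<phi> ` unit_disk = unit_disk - {0}" "p_valent 2 \<phi>"
    using image_exp_strip[OF g(3)] p_valent_exp_strip[OF g(2,3)] unfolding \<phi>_def by auto
  have \<phi>1: "cmod (\<phi> z) < 1" if "z \<in> unit_disk" for z
    using \<phi>(1) that by (metis DiffD1 image_eqI mem_ball_0)
  have hol: "\<psi> holomorphic_on unit_disk"
    unfolding \<psi>_def half_moebius_def \<phi>_def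
    using half_moebius_denominator[OF \<phi>1] unfolding \<phi>_def by (intro holomorphic_intros g) auto
  have im: "\<psi> ` unit_disk = unit_disk"
  proof -
    have "\<psi> ` unit_disk = (\<lambda>v. (half_moebius v)\<^sup>2) ` (\<phi> ` unit_disk)"
      by (simp add: \<psi>_def image_image)
    then show ?thesis
      by (simp only: \<phi>(1) half_moebius_square_image)
  qed
  have "p_valent (2 * 2) \<psi>"
    unfolding \<psi>_def
    by (rule p_valent_compose[OF \<phi>(2)]) (use \<phi>(1) half_moebius_square_valence in auto)
  then have val: "p_valent 4 \<psi>" by simp
  have U: "(\<lambda>z. strip_barrier (g z)) holomorphic_on unit_disk"
    by (intro holomorphic_intros g)
  have key: "\<exists>C\<ge>0. \<forall>n. \<forall>z\<in>unit_disk. (cmod (\<psi> z)) ^ (2*n) / (1 - (cmod (\<psi> z))\<^sup>2)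
      \<le> C / real (Suc n) ^ N * Re (strip_barrier (g z))" for N
  proof -
    \<comment> \<open>The power of \<open>9/2\<close> comes from
      \<open>1 / y \<le> 9/2 * (1 / x)\<close>, the factorial from bounding a power by
      \<open>exp\<close>, \<open>exp 1\<close> from
      \<open>exp (1 / x) = exp 1 * exp (1 / x - 1)\<close>, and 2 from the half in the barrier
      estimate.\<close>
    define D :: real where "D = (9/2) ^ Suc N * (2 * exp 1 * fact (Suc N))"
    have "(9/2) ^ Suc N * 1 \<le> (9/2) ^ Suc N * (2 * exp 1 * fact (Suc N) :: real)"
    proof (intro mult_left_mono)
      have "1 * 1 \<le> 2 * exp 1 * (fact (Suc N) :: real)"
        by (intro mult_mono fact_ge_1) (use exp_ge_add_one_self[of "1::real"] in auto)
      then show "1 \<le> 2 * exp 1 * (fact (Suc N) :: real)" by simp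
    qed auto
    then have D: "(9/2) ^ Suc N \<le> D" by (simp add: D_def)
    have "(cmod (\<psi> z)) ^ (2*n) / (1 - (cmod (\<psi> z))\<^sup>2)
        \<le> (exp 1 * fact N * D) / real (Suc n) ^ N * Re (strip_barrier (g z))" if z: "z \<in> unit_disk" for n z
    proof -
      define x where "x = Re (g z)"
      \<comment> \<open>One third of \<open>1 - \<bar>\<phi> z\<bar>^2\<close>, the lower bound for
        \<open>1 - m\<close> from \<open>half_moebius_norm_ge\<close>.\<close>
      define y where "y = (1 - exp (- 2 * x)) / 3"
      define m where "m = (cmod (half_moebius (\<phi> z)))\<^sup>2"
      have gz: "g z \<in> strip_domain H" using z g(3) by blast
      then have x: "x > 0" "H x < Im (g z)" by (auto simp: strip_domain_def x_def)
      have "exp (- 2 * x) < 1" using x by simp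
      then have y: "0 < y" "y \<le> 1"
        using less_trans[of "-1" 0 "exp (- 2 * x)"] exp_gt_zero by (simp_all add: y_def)
      have "(cmod (\<phi> z))\<^sup>2 = exp (- 2 * x)"
        by (simp add: \<phi>_def x_def power2_eq_square flip: exp_add)
      then have m: "m \<le> 1 - y"
        using half_moebius_norm_ge[OF \<phi>1[OF z]] by (simp add: m_def y_def field_simps)
      have m0: "0 \<le> m" by (simp add: m_def)
      have \<psi>m: "cmod (\<psi> z) = m" by (simp add: \<psi>_def m_def norm_power)
      \<comment> \<open>Half the exponent can be given away:
        \<open>m \<le> 1 - y \<le> exp (- y)\<close> already yields exponential decay in
        \<open>n * y\<close>.\<close>
      have "m ^ (2*n) \<le> m ^ n"
        using m0 m y by (intro power_decreasing) auto
      also have "\<dots> \<le> (exp (- y)) ^ n"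
        using m m0 exp_ge_add_one_self[of "- y"] by (intro power_mono) auto
      also have "\<dots> = exp (- (real n * y))"
        by (simp add: exp_of_nat_mult[symmetric])
      finally have e1: "m ^ (2*n) \<le> exp (- (real n * y))" .
      have "m\<^sup>2 \<le> m" using m0 m y by (simp add: power2_eq_square mult_left_le)
      then have "y \<le> 1 - m\<^sup>2" using m by linarith
      then have "m ^ (2*n) / (1 - m\<^sup>2) \<le> exp (- (real n * y)) / y"
        using e1 y m0 by (intro frac_le) auto
      also have "\<dots> \<le> exp 1 * fact N / real (Suc n) ^ N * (1 / y) ^ Suc N"
        by (rule exp_decay_bound[OF y])
      also have "\<dots> \<le> exp 1 * fact N / real (Suc n) ^ N * (D * Re (strip_barrier (g z)))"
      proof (intro mult_left_mono)
        have "1 + 2 * x \<le> exp (2 * x)" by (rule exp_ge_add_one_self)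
        then have "exp (- (2 * x)) \<le> 1 / (1 + 2 * x)"
          using x by (simp add: exp_minus field_simps)
        then have yge: "2 * x / (1 + 2 * x) / 3 \<le> y"
          using x by (simp add: y_def field_simps)
        show "(1 / y) ^ Suc N \<le> D * Re (strip_barrier (g z))"
        \<comment> \<open>For \<open>x < 1\<close> the exponential term of the barrier beats the
          power of \<open>1 / y\<close>. For \<open>x \<ge> 1\<close> the number \<open>y\<close> is
          at least \<open>2/9\<close>, and a barrier of at least 1 is enough.\<close>
        proof (cases "x < 1")
          case True
          have "2 * x / 9 \<le> 2 * x / (1 + 2 * x) / 3"
            using True x by (simp add: divide_simps)
          then have "2 * x / 9 \<le> y" using yge by linarith
          then have "1 / y \<le> 9/2 * (1 / x)"
            using x y by (simp add: field_simps)
          then have "(1 / y) ^ Suc N \<le> (9/2 * (1 / x)) ^ Suc N"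
            using y by (intro power_mono) auto
          also have "\<dots> = (9/2) ^ Suc N * (fact (Suc N) * ((1 / x) ^ Suc N / fact (Suc N)))"
            by (simp only: power_mult_distrib) (simp del: fact_Suc power_Suc)
          also have "\<dots> \<le> (9/2) ^ Suc N * (fact (Suc N) * exp (1 / x))"
            using x by (intro mult_left_mono power_div_fact_le_exp) (auto simp del: fact_Suc)
          also have "exp (1 / x) = exp 1 * exp (1 / x - 1)"
            by (simp flip: exp_add)
          also have "(9/2) ^ Suc N * (fact (Suc N) * (exp 1 * exp (1 / x - 1))) = D * (exp (1 / x - 1) / 2)"
            by (simp add: D_def del: fact_Suc power_Suc)
          also have "\<dots> \<le> D * Re (strip_barrier (g z))"
          proof (rule mult_left_mono)
            have "1 / x - 1 \<le> Im (g z)" using x by (simp add: H_def)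
            then have "exp (1 / x - 1) \<le> exp (Im (g z))" by simp
            moreover have "1 + x + exp (Im (g z)) / 2 \<le> Re (strip_barrier (g z))"
              using strip_barrier_ge(2)[OF gz] H0 True by (simp add: x_def)
            ultimately show "exp (1 / x - 1) / 2 \<le> Re (strip_barrier (g z))"
              using x(1) by linarith
          qed (simp add: D_def)
          finally show ?thesis .
        next
          case False
          then have "2 / 9 \<le> 2 * x / (1 + 2 * x) / 3"
            using x by (simp add: divide_simps)
          then have "2 / 9 \<le> y" using yge by linarith
          then have "1 / y \<le> 9/2"
            using y by (simp add: field_simps)
          then have "(1 / y) ^ Suc N \<le> (9/2) ^ Suc N"
            using y by (intro power_mono) auto
          also have "\<dots> \<le> D * 1" using D by simp
          also have "\<dots> \<le> D * Re (strip_barrier (g z))"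
            using strip_barrier_ge(1)[OF gz] H0 x by (intro mult_left_mono) (auto simp: D_def x_def)
          finally show ?thesis .
        qed
      qed auto
      finally show ?thesis
        by (simp add: \<psi>m mult_ac)
    qed
    moreover have "0 \<le> exp 1 * fact N * D" by (simp add: D_def)
    ultimately show ?thesis by blast
  qed
  have "schatten_class p (composition_op \<psi>)" if "0 < p" for p
    by (rule schatten_class_composition[OF hol _ U key that]) (use im in auto)
  then show ?thesis
    using hol im val by blast
qed

theorem theorem1p2:
  shows "(\<forall>\<delta> :: real \<Rightarrow> real.
            (\<forall>h\<in>{0<..<1}. \<delta> h \<in> {0<..<1}) \<and> mono_on {0<..<1} \<delta> \<longrightarrow>
            (\<exists>\<phi> h0. \<phi> holomorphic_on unit_disk \<and> p_valent 2 \<phi> \<and>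
                     \<phi> ` unit_disk = unit_disk - {0} \<and> 0 < h0 \<and> h0 < 1 \<and>
                     (\<forall>h. 0 < h \<and> h \<le> h0 \<longrightarrow>
                        circle_measurable {z \<in> sphere 0 1. cmod (radial_limit \<phi> z) \<ge> 1 - h} \<and>
                        circle_measure {z \<in> sphere 0 1. cmod (radial_limit \<phi> z) \<ge> 1 - h} \<le> \<delta> h)))
         \<and> (\<exists>\<psi>. \<psi> holomorphic_on unit_disk \<and> \<psi> ` unit_disk = unit_disk \<and> p_valent 4 \<psi> \<and>
                (\<forall>p>0. schatten_class p (composition_op \<psi>)))"
proof (intro conjI allI impI)
  fix \<delta> :: "real \<Rightarrow> real"
  assume "(\<forall>h\<in>{0<..<1}. \<delta> h \<in> {0<..<1}) \<and> mono_on {0<..<1} \<delta>"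
  then show "\<exists>\<phi> h0. \<phi> holomorphic_on unit_disk \<and> p_valent 2 \<phi> \<and>
      \<phi> ` unit_disk = unit_disk - {0} \<and> 0 < h0 \<and> h0 < 1 \<and>
      (\<forall>h. 0 < h \<and> h \<le> h0 \<longrightarrow>
        circle_measurable {z \<in> sphere 0 1. cmod (radial_limit \<phi> z) \<ge> 1 - h} \<and>
        circle_measure {z \<in> sphere 0 1. cmod (radial_limit \<phi> z) \<ge> 1 - h} \<le> \<delta> h)"
    by (intro exists_two_valent_symbol) auto
qed (rule exists_surjective_schatten_symbol)

end
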